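(* Let $\Gamma_1,\Gamma_2$ be infinite countable groups with a common subgroup $\Sigma$, and let $\Gamma=\Gamma_1*_{\Sigma}\Gamma_2$ be the amalgamated free product. If $\Sigma$ is highly core-free in both $\Gamma_1$ and $\Gamma_2$, then $\Gamma$ admits a faithful and highly transitive action on an infinite countable set. If moreover $\Gamma_1,\Gamma_2$ are amenable and $\Sigma$ is finite, then the action can be chosen to be amenable (that is, there is then an action of $\Gamma$ on an infinite countable set which is simultaneously faithful, highly transitive and amenable).
   Context: For a subgroup $\Sigma<H$ and $S\subset H$, put $\mathrm{Core}_S(\Sigma)=\bigcap_{h\in S}h^{-1}\Sigma h$. A subgroup $\Sigma<H$ is highly core-free if, for every finite subset $F\subset H$, every $n\geq 1$ and all non-empty subsets $S_1,\dots,S_n\subset H$ with $H\setminus\Sigma F\subset\bigcup_{k=1}^n S_k$, there exists $1\leq k\leq n$ such that $\mathrm{Core}_{S_k}(\Sigma)=\{1\}$. An action of a countable group $\Gamma$ on an infinite countable set $X$ is highly transitive if for all $n\geq 1$, for any pairwise distinct $x_1,\dots,x_n\in X$ and any pairwise distinct $y_1,\dots,y_n\in X$ there is $g\in\Gamma$ with $gx_k=y_k$ for all $k$. An action is faithful if only $1\in\Gamma$ acts as the identity. An action $\Gamma\curvearrowright X$ is amenable if there is a $\Gamma$-invariant finitely additive probability measure on all subsets of $X$ (for countable $\Gamma$: equivalently a Følner sequence of finite non-empty subsets $C_n\subset X$ with $|gC_n\triangle C_n|/|C_n|\to 0$ for all $g\in\Gamma$). *)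

theory Defs
  imports Complex_Main "HOL-Algebra.Group_Action" "HOL-Library.Countable_Set"
begin

section \<open>Amalgamated free products\<close>

text \<open>
  The common subgroup is a group \<open>S\<close> together with injective homomorphisms \<open>i1\<close>, \<open>i2\<close> into the
  two factors.  The amalgamated free product is the group of all words in the letters
  \<open>Inl x\<close> (\<open>x \<in> G1\<close>) and \<open>Inr y\<close> (\<open>y \<in> G2\<close>), modulo the congruence generated by the
  multiplication tables of both factors and the identifications \<open>i1 s = i2 s\<close>.  The inverse of a
  word is obtained by reversing it and inverting its letters, so no formal inverse letters are
  needed.
\<close>

definition amalg_words ::
    "('a, 'm) monoid_scheme \<Rightarrow> ('b, 'n) monoid_scheme \<Rightarrow> ('a + 'b) list set" where
  "amalg_words G1 G2 = lists (carrier G1 <+> carrier G2)"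

inductive amalg_eq ::
    "('a, 'm) monoid_scheme \<Rightarrow> ('b, 'n) monoid_scheme \<Rightarrow> ('c, 'k) monoid_scheme \<Rightarrow>
     ('c \<Rightarrow> 'a) \<Rightarrow> ('c \<Rightarrow> 'b) \<Rightarrow> ('a + 'b) list \<Rightarrow> ('a + 'b) list \<Rightarrow> bool"
  for G1 G2 S i1 i2 where
  refl: "u \<in> amalg_words G1 G2 \<Longrightarrow> amalg_eq G1 G2 S i1 i2 u u"
| sym: "amalg_eq G1 G2 S i1 i2 u v \<Longrightarrow> amalg_eq G1 G2 S i1 i2 v u"
| trans: "amalg_eq G1 G2 S i1 i2 u v \<Longrightarrow> amalg_eq G1 G2 S i1 i2 v w \<Longrightarrow> amalg_eq G1 G2 S i1 i2 u w"
| append: "amalg_eq G1 G2 S i1 i2 u u' \<Longrightarrow> amalg_eq G1 G2 S i1 i2 v v' \<Longrightarrow>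
    amalg_eq G1 G2 S i1 i2 (u @ v) (u' @ v')"
| one1: "amalg_eq G1 G2 S i1 i2 [Inl \<one>\<^bsub>G1\<^esub>] []"
| one2: "amalg_eq G1 G2 S i1 i2 [Inr \<one>\<^bsub>G2\<^esub>] []"
| mult1: "x \<in> carrier G1 \<Longrightarrow> x' \<in> carrier G1 \<Longrightarrow>
    amalg_eq G1 G2 S i1 i2 [Inl x, Inl x'] [Inl (x \<otimes>\<^bsub>G1\<^esub> x')]"
| mult2: "y \<in> carrier G2 \<Longrightarrow> y' \<in> carrier G2 \<Longrightarrow>
    amalg_eq G1 G2 S i1 i2 [Inr y, Inr y'] [Inr (y \<otimes>\<^bsub>G2\<^esub> y')]"
| glue: "s \<in> carrier S \<Longrightarrow> amalg_eq G1 G2 S i1 i2 [Inl (i1 s)] [Inr (i2 s)]"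

definition amalg_class ::
    "('a, 'm) monoid_scheme \<Rightarrow> ('b, 'n) monoid_scheme \<Rightarrow> ('c, 'k) monoid_scheme \<Rightarrow>
     ('c \<Rightarrow> 'a) \<Rightarrow> ('c \<Rightarrow> 'b) \<Rightarrow> ('a + 'b) list \<Rightarrow> ('a + 'b) list set" where
  "amalg_class G1 G2 S i1 i2 u = {v. amalg_eq G1 G2 S i1 i2 u v}"

definition amalg ::
    "('a, 'm) monoid_scheme \<Rightarrow> ('b, 'n) monoid_scheme \<Rightarrow> ('c, 'k) monoid_scheme \<Rightarrow>
     ('c \<Rightarrow> 'a) \<Rightarrow> ('c \<Rightarrow> 'b) \<Rightarrow> ('a + 'b) list set monoid" where
  "amalg G1 G2 S i1 i2 =
    \<lparr>carrier = amalg_class G1 G2 S i1 i2 ` amalg_words G1 G2,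
     mult = (\<lambda>A B. \<Union>u\<in>A. \<Union>v\<in>B. amalg_class G1 G2 S i1 i2 (u @ v)),
     one = amalg_class G1 G2 S i1 i2 []\<rparr>"

lemma amalg_eq_words:
  assumes "group G1" "group G2" "i1 \<in> hom S G1" "i2 \<in> hom S G2"
    and "amalg_eq G1 G2 S i1 i2 u v"
  shows "u \<in> amalg_words G1 G2 \<and> v \<in> amalg_words G1 G2"
  using assms(5)
  by (induction)
     (use assms(1-4) in \<open>auto simp: amalg_words_def hom_def Pi_iff group.is_monoid monoid.m_closed
        intro: monoid.one_closed\<close>)

lemma amalg_class_eq_iff:
  assumes "v \<in> amalg_words G1 G2"
  shows "amalg_class G1 G2 S i1 i2 u = amalg_class G1 G2 S i1 i2 v \<longleftrightarrow> amalg_eq G1 G2 S i1 i2 u v"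
  unfolding amalg_class_def using assms
  by (auto simp: set_eq_iff intro: amalg_eq.refl amalg_eq.sym amalg_eq.trans)

lemma amalg_mult_class:
  assumes "u \<in> amalg_words G1 G2" "v \<in> amalg_words G1 G2"
  shows "amalg_class G1 G2 S i1 i2 u \<otimes>\<^bsub>amalg G1 G2 S i1 i2\<^esub> amalg_class G1 G2 S i1 i2 v =
    amalg_class G1 G2 S i1 i2 (u @ v)"
  using assms unfolding amalg_def amalg_class_def
  by (auto intro: amalg_eq.refl amalg_eq.sym amalg_eq.trans amalg_eq.append)

theorem group_amalg:
  assumes "group G1" "group G2" "i1 \<in> hom S G1" "i2 \<in> hom S G2"
  shows "group (amalg G1 G2 S i1 i2)"
proof -
  interpret A: group G1 by fact
  interpret B: group G2 by fact
  let ?c = "amalg_class G1 G2 S i1 i2"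
  let ?P = "amalg G1 G2 S i1 i2"
  let ?W = "amalg_words G1 G2"
  have car: "carrier ?P = ?c ` ?W" and one: "\<one>\<^bsub>?P\<^esub> = ?c []" by (auto simp: amalg_def)
  have W: "[] \<in> ?W" "\<And>u v. u @ v \<in> ?W \<longleftrightarrow> u \<in> ?W \<and> v \<in> ?W"
    by (auto simp: amalg_words_def)
  have inv: "\<exists>v\<in>?W. amalg_eq G1 G2 S i1 i2 (v @ u) []" if "u \<in> ?W" for u
    using that
  proof (induction u)
    case Nil
    then show ?case using W(1) amalg_eq.refl by fastforce
  next
    case (Cons a u)
    then have a: "a \<in> carrier G1 <+> carrier G2" and u: "u \<in> ?W"
      by (auto simp: amalg_words_def)
    from Cons.IH[OF u] obtain v where v: "v \<in> ?W" "amalg_eq G1 G2 S i1 i2 (v @ u) []" by blast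
    obtain b where b: "b \<in> carrier G1 <+> carrier G2" "amalg_eq G1 G2 S i1 i2 [b, a] []"
    proof (cases a)
      case (Inl x)
      then have x: "x \<in> carrier G1" using a by auto
      have "amalg_eq G1 G2 S i1 i2 [Inl (inv\<^bsub>G1\<^esub> x), Inl x] []"
        using amalg_eq.mult1[of "inv\<^bsub>G1\<^esub> x" G1 x] amalg_eq.one1 x
        by (metis A.inv_closed A.l_inv amalg_eq.trans)
      then show ?thesis using that[of "Inl (inv\<^bsub>G1\<^esub> x)"] x Inl by auto
    next
      case (Inr x)
      then have x: "x \<in> carrier G2" using a by auto
      have "amalg_eq G1 G2 S i1 i2 [Inr (inv\<^bsub>G2\<^esub> x), Inr x] []"
        using amalg_eq.mult2[of "inv\<^bsub>G2\<^esub> x" G2 x] amalg_eq.one2 x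
        by (metis B.inv_closed B.l_inv amalg_eq.trans)
      then show ?thesis using that[of "Inr (inv\<^bsub>G2\<^esub> x)"] x Inr by auto
    qed
    have "amalg_eq G1 G2 S i1 i2 (v @ ([b, a] @ u)) (v @ ([] @ u))"
      by (intro amalg_eq.append b amalg_eq.refl v u)
    then have "amalg_eq G1 G2 S i1 i2 ((v @ [b]) @ a # u) []"
      using v(2) by (auto intro: amalg_eq.trans)
    moreover have "v @ [b] \<in> ?W" using v b by (auto simp: amalg_words_def)
    ultimately show ?case by blast
  qed
  show ?thesis
  proof (rule groupI)
    fix x assume "x \<in> carrier ?P"
    then obtain u where u: "u \<in> ?W" "x = ?c u" by (auto simp: car)
    obtain v where v: "v \<in> ?W" "amalg_eq G1 G2 S i1 i2 (v @ u) []" using inv[OF u(1)] by blast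
    show "\<exists>y\<in>carrier ?P. y \<otimes>\<^bsub>?P\<^esub> x = \<one>\<^bsub>?P\<^esub>"
      using u v W by (auto simp: car one amalg_mult_class amalg_class_eq_iff intro!: bexI[of _ v])
  qed (use W in \<open>auto simp: car one amalg_mult_class\<close>)
qed

theorem amalg_cocone:
  assumes "group G1" "group G2" "i1 \<in> hom S G1" "i2 \<in> hom S G2"
  shows "(\<lambda>x. amalg_class G1 G2 S i1 i2 [Inl x]) \<in> hom G1 (amalg G1 G2 S i1 i2)"
    and "(\<lambda>y. amalg_class G1 G2 S i1 i2 [Inr y]) \<in> hom G2 (amalg G1 G2 S i1 i2)"
    and "\<And>s. s \<in> carrier S \<Longrightarrow>
      amalg_class G1 G2 S i1 i2 [Inl (i1 s)] = amalg_class G1 G2 S i1 i2 [Inr (i2 s)]"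
proof -
  interpret A: group G1 by fact
  interpret B: group G2 by fact
  let ?c = "amalg_class G1 G2 S i1 i2"
  have W: "\<And>x. x \<in> carrier G1 \<Longrightarrow> [Inl x] \<in> amalg_words G1 G2"
    "\<And>y. y \<in> carrier G2 \<Longrightarrow> [Inr y] \<in> amalg_words G1 G2" by (auto simp: amalg_words_def)
  have car: "carrier (amalg G1 G2 S i1 i2) = ?c ` amalg_words G1 G2" by (simp add: amalg_def)
  have m: "x \<in> carrier G1 \<Longrightarrow> x' \<in> carrier G1 \<Longrightarrow> ?c [Inl x, Inl x'] = ?c [Inl (x \<otimes>\<^bsub>G1\<^esub> x')]"
    "y \<in> carrier G2 \<Longrightarrow> y' \<in> carrier G2 \<Longrightarrow> ?c [Inr y, Inr y'] = ?c [Inr (y \<otimes>\<^bsub>G2\<^esub> y')]" for x x' y y'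
    by (simp_all add: amalg_class_eq_iff W amalg_eq.mult1 amalg_eq.mult2)
  show "(\<lambda>x. ?c [Inl x]) \<in> hom G1 (amalg G1 G2 S i1 i2)"
    by (rule homI) (simp_all add: car amalg_mult_class W m)
  show "(\<lambda>y. ?c [Inr y]) \<in> hom G2 (amalg G1 G2 S i1 i2)"
    by (rule homI) (simp_all add: car amalg_mult_class W m)
  show "?c [Inl (i1 s)] = ?c [Inr (i2 s)]" if "s \<in> carrier S" for s
    using that hom_in_carrier[OF assms(4)] by (simp add: amalg_class_eq_iff W amalg_eq.glue)
qed

theorem amalg_universal:
  fixes K :: "('d, 'l) monoid_scheme"
  assumes "group G1" "group G2" "i1 \<in> hom S G1" "i2 \<in> hom S G2" "group K"
    and f1: "f1 \<in> hom G1 K" and f2: "f2 \<in> hom G2 K"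
    and f12: "\<And>s. s \<in> carrier S \<Longrightarrow> f1 (i1 s) = f2 (i2 s)"
  obtains f where "f \<in> hom (amalg G1 G2 S i1 i2) K"
    "\<And>x. x \<in> carrier G1 \<Longrightarrow> f (amalg_class G1 G2 S i1 i2 [Inl x]) = f1 x"
    "\<And>y. y \<in> carrier G2 \<Longrightarrow> f (amalg_class G1 G2 S i1 i2 [Inr y]) = f2 y"
proof -
  interpret K: group K by fact
  let ?c = "amalg_class G1 G2 S i1 i2"
  let ?W = "amalg_words G1 G2"
  define e where "e = (\<lambda>u. foldr (\<lambda>a k. case_sum f1 f2 a \<otimes>\<^bsub>K\<^esub> k) u \<one>\<^bsub>K\<^esub>)"
  have cl: "e u \<in> carrier K" if "u \<in> ?W" for u
    using that f1 f2 by (induction u) (auto simp: e_def amalg_words_def hom_def Pi_iff)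
  have app: "e (u @ v) = e u \<otimes>\<^bsub>K\<^esub> e v" if "u \<in> ?W" "v \<in> ?W" for u v
    using that
  proof (induction u)
    case Nil
    then show ?case using cl[of v] by (simp add: e_def)
  next
    case (Cons a u)
    then have a: "case_sum f1 f2 a \<in> carrier K" and u: "u \<in> ?W"
      using f1 f2 by (auto simp: amalg_words_def hom_def Pi_iff)
    have "e ((a # u) @ v) = case_sum f1 f2 a \<otimes>\<^bsub>K\<^esub> e (u @ v)" by (simp add: e_def)
    also have "\<dots> = case_sum f1 f2 a \<otimes>\<^bsub>K\<^esub> (e u \<otimes>\<^bsub>K\<^esub> e v)" using Cons.IH u Cons.prems by simp
    also have "\<dots> = e (a # u) \<otimes>\<^bsub>K\<^esub> e v"
      using a cl[OF u] cl[OF Cons.prems(2)] by (simp add: e_def K.m_assoc)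
    finally show ?case .
  qed
  have sing: "x \<in> carrier G1 \<Longrightarrow> e [Inl x] = f1 x" "y \<in> carrier G2 \<Longrightarrow> e [Inr y] = f2 y" for x y
    using f1 f2 by (auto simp: e_def hom_def Pi_iff)
  have one: "f1 \<one>\<^bsub>G1\<^esub> = \<one>\<^bsub>K\<^esub>" "f2 \<one>\<^bsub>G2\<^esub> = \<one>\<^bsub>K\<^esub>"
    using hom_one[OF f1 assms(1,5)] hom_one[OF f2 assms(2,5)] by auto
  have resp: "e u = e v" if "amalg_eq G1 G2 S i1 i2 u v" for u v
    using that
  proof (induction)
    case (append u u' v v')
    then show ?case using amalg_eq_words[OF assms(1-4)] app by metis
  next
    case (mult1 x x')
    then show ?case using f1 by (simp add: e_def hom_def Pi_iff)
  next
    case (mult2 y y')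
    then show ?case using f2 by (simp add: e_def hom_def Pi_iff)
  next
    case (glue s)
    then show ?case using f12 by (simp add: e_def)
  qed (auto simp: e_def one)
  define f where "f = (\<lambda>C. e (SOME u. u \<in> C))"
  have f: "f (?c u) = e u" if "u \<in> ?W" for u
  proof -
    have "u \<in> ?c u" using that by (simp add: amalg_class_def amalg_eq.refl)
    then have "(SOME v. v \<in> ?c u) \<in> ?c u" by (rule someI)
    then show ?thesis using resp by (simp add: f_def amalg_class_def)
  qed
  have W: "x \<in> carrier G1 \<Longrightarrow> [Inl x] \<in> ?W" "y \<in> carrier G2 \<Longrightarrow> [Inr y] \<in> ?W"
    "u \<in> ?W \<Longrightarrow> v \<in> ?W \<Longrightarrow> u @ v \<in> ?W" for x y u v
    by (auto simp: amalg_words_def)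
  have "f \<in> hom (amalg G1 G2 S i1 i2) K"
  proof -
    have "carrier (amalg G1 G2 S i1 i2) = ?c ` ?W" by (simp add: amalg_def)
    then show ?thesis by (auto simp: hom_def amalg_mult_class f W cl app)
  qed
  then show thesis by (rule that) (simp_all add: f W sing)
qed


section \<open>Highly core-free subgroups\<close>

definition Core :: "('a, 'm) monoid_scheme \<Rightarrow> 'a set \<Rightarrow> 'a set \<Rightarrow> 'a set" where
  "Core H S \<Sigma> = (\<Inter>h\<in>S. (inv\<^bsub>H\<^esub> h) <#\<^bsub>H\<^esub> \<Sigma> #>\<^bsub>H\<^esub> h)"

definition highly_core_free :: "('a, 'm) monoid_scheme \<Rightarrow> 'a set \<Rightarrow> bool" where
  "highly_core_free H \<Sigma> \<longleftrightarrow>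
    subgroup \<Sigma> H \<and>
    (\<forall>F n (S :: nat \<Rightarrow> 'a set).
      finite F \<and> F \<subseteq> carrier H \<and> n \<ge> 1 \<and>
      (\<forall>k\<in>{1..n}. S k \<noteq> {} \<and> S k \<subseteq> carrier H) \<and>
      carrier H - (\<Sigma> <#>\<^bsub>H\<^esub> F) \<subseteq> (\<Union>k\<in>{1..n}. S k)
      \<longrightarrow> (\<exists>k\<in>{1..n}. Core H (S k) \<Sigma> = {\<one>\<^bsub>H\<^esub>}))"


section \<open>Highly transitive and amenable actions\<close>

definition highly_transitive ::
    "('a, 'm) monoid_scheme \<Rightarrow> 'x set \<Rightarrow> ('a \<Rightarrow> 'x \<Rightarrow> 'x) \<Rightarrow> bool" where
  "highly_transitive G X \<phi> \<longleftrightarrow>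
    (\<forall>n\<ge>1. \<forall>x y :: nat \<Rightarrow> 'x.
      x \<in> {1..n} \<rightarrow> X \<and> inj_on x {1..n} \<and> y \<in> {1..n} \<rightarrow> X \<and> inj_on y {1..n}
      \<longrightarrow> (\<exists>g\<in>carrier G. \<forall>k\<in>{1..n}. \<phi> g (x k) = y k))"

definition fin_additive_prob :: "'x set \<Rightarrow> ('x set \<Rightarrow> real) \<Rightarrow> bool" where
  "fin_additive_prob X \<mu> \<longleftrightarrow>
    (\<forall>A\<subseteq>X. \<mu> A \<ge> 0) \<and> \<mu> X = 1 \<and>
    (\<forall>A\<subseteq>X. \<forall>B\<subseteq>X. A \<inter> B = {} \<longrightarrow> \<mu> (A \<union> B) = \<mu> A + \<mu> B)"

definition amenable_action ::
    "('a, 'm) monoid_scheme \<Rightarrow> 'x set \<Rightarrow> ('a \<Rightarrow> 'x \<Rightarrow> 'x) \<Rightarrow> bool" where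
  "amenable_action G X \<phi> \<longleftrightarrow>
    (\<exists>\<mu>. fin_additive_prob X \<mu> \<and> (\<forall>g\<in>carrier G. \<forall>A\<subseteq>X. \<mu> (\<phi> g ` A) = \<mu> A))"

text \<open>Amenability of a discrete group: its left translation action on itself is amenable.\<close>

definition amenable_group :: "('a, 'm) monoid_scheme \<Rightarrow> bool" where
  "amenable_group G \<longleftrightarrow> amenable_action G (carrier G) (\<lambda>g h. g \<otimes>\<^bsub>G\<^esub> h)"

end

theory Submission
  imports Defs "HOL-Library.Disjoint_Sets" "HOL-Analysis.Function_Topology"
begin

text \<open>
  Let \<open>X\<close> and \<open>Y\<close> be countable sets with free actions of the two factors, each with infinitely
  many orbits.  A bijection \<open>w : X \<rightarrow> Y\<close> that is equivariant under the common subgroup turns \<open>X\<close>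
  into a set with an action of the amalgam: the first factor acts as given and the second one
  through conjugation by \<open>w\<close>.  A generic \<open>w\<close> works, that is, one obtained as the union of a chain
  of equivariant partial bijections meeting countably many dense requirements.

  High transitivity: being highly core-free says exactly that finitely many points can be moved by
  a single group element to inequivalent points away from a given finite union of subgroup orbits.
  There \<open>w\<close> is still undefined, so it can be extended such that an element of the second factor
  matches the moved points.  Faithfulness: every element outside the factors is represented by a
  reduced word, and a partial bijection can be extended along the trajectory of a fresh point so
  that the word moves it.  Amenability: invariant means give Folner sets, by Hall's theorem
  applied to a putative paradoxical decomposition.  As the common subgroup is finite, copies of
  Folner sets of the two factors can be made unions of equally many subgroup orbits, and \<open>w\<close> is
  extended so as to map one onto the other.
\<close>

section \<open>Amenability and Folner sets\<close>

definition hall_condition :: "('i \<Rightarrow> 'b set) \<Rightarrow> bool" where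
  "hall_condition A \<longleftrightarrow> (\<forall>J. finite J \<longrightarrow> card J \<le> card (\<Union>(A ` J)))"

lemma hall_conditionD: "hall_condition A \<Longrightarrow> finite J \<Longrightarrow> card J \<le> card (\<Union>(A ` J))"
  by (simp add: hall_condition_def)

text \<open>Rado's argument: violations of both removals would contradict the condition by submodularity of
  the cardinality of unions.\<close>

lemma hall_condition_remove:
  assumes hall: "hall_condition A" and fin: "\<And>i. finite (A i)" and ne: "x1 \<noteq> x2"
  shows "hall_condition (A(i := A i - {x1})) \<or> hall_condition (A(i := A i - {x2}))"
proof (rule ccontr)
  \<comment> \<open>A violating index set contains \<open>i\<close>, since elsewhere the family is
    unchanged. Taking \<open>i\<close> out of it lowers its size by one, which weakens the strict
    inequality to the one stated.\<close>
  have witness: "\<exists>J. finite J \<and> i \<notin> J \<and> card (\<Union>(A ` J) \<union> (A i - {x})) \<le> card J"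
    if neg: "\<not> hall_condition (A(i := A i - {x}))" for x
  proof -
    obtain J where J: "finite J" "card (\<Union>((A(i := A i - {x})) ` J)) < card J"
      using neg by (auto simp: hall_condition_def not_le)
    have "i \<in> J"
    proof (rule ccontr)
      assume "i \<notin> J"
      then have "(A(i := A i - {x})) ` J = A ` J" by auto
      then show False using J hall_conditionD[OF hall, of J] by simp
    qed
    moreover have "\<Union>((A(i := A i - {x})) ` J) = \<Union>(A ` (J - {i})) \<union> (A i - {x})"
      using \<open>i \<in> J\<close> by auto
    ultimately show ?thesis using J by (intro exI[of _ "J - {i}"]) auto
  qed
  assume "\<not> ?thesis"
  then obtain J1 J2 where J: "finite J1" "i \<notin> J1" "card (\<Union>(A ` J1) \<union> (A i - {x1})) \<le> card J1"
    "finite J2" "i \<notin> J2" "card (\<Union>(A ` J2) \<union> (A i - {x2})) \<le> card J2"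
    using witness by metis
  let ?U1 = "\<Union>(A ` J1) \<union> (A i - {x1})" and ?U2 = "\<Union>(A ` J2) \<union> (A i - {x2})"
  have f: "finite ?U1" "finite ?U2" using J fin by auto
  \<comment> \<open>As the deleted points differ, each of them survives on the other side, so all of
    \<open>A i\<close> is recovered and the condition applies to an index set that includes
    \<open>i\<close>.\<close>
  have "?U1 \<union> ?U2 = \<Union>(A ` insert i (J1 \<union> J2))" using ne by auto
  then have "card (insert i (J1 \<union> J2)) \<le> card (?U1 \<union> ?U2)"
    using hall_conditionD[OF hall, of "insert i (J1 \<union> J2)"] J by simp
  moreover have "card (J1 \<inter> J2) \<le> card (?U1 \<inter> ?U2)"
  proof -
    have "card (J1 \<inter> J2) \<le> card (\<Union>(A ` (J1 \<inter> J2)))"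
      using hall J by (intro hall_conditionD) auto
    also have "\<dots> \<le> card (?U1 \<inter> ?U2)" using f by (intro card_mono) auto
    finally show ?thesis .
  qed
  moreover have "card (insert i (J1 \<union> J2)) = Suc (card (J1 \<union> J2))" using J by auto
  moreover have "card J1 + card J2 = card (J1 \<union> J2) + card (J1 \<inter> J2)"
    by (rule card_Un_Int[OF J(1,4)])
  moreover have "card ?U1 + card ?U2 = card (?U1 \<union> ?U2) + card (?U1 \<inter> ?U2)"
    by (rule card_Un_Int[OF f])
  ultimately show False using J by linarith
qed

text \<open>Points of \<open>A i\<close> are deleted by the preceding lemma until one is left; the
  condition for the index set \<open>{i}\<close> alone keeps \<open>A i\<close> from being
  empty.\<close>

lemma hall_condition_singleton:
  assumes "hall_condition A" and "\<And>i. finite (A i)"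
  shows "\<exists>x\<in>A i. hall_condition (A(i := {x}))"
  using assms
proof (induction "card (A i)" arbitrary: A rule: less_induct)
  case less
  have "card {i} \<le> card (\<Union>(A ` {i}))"
    using less.prems(1) by (rule hall_conditionD) simp
  then have "1 \<le> card (A i)" by simp
  show ?case
  proof (cases "card (A i) = 1")
    case True
    then obtain x where "A i = {x}" by (auto simp: card_1_singleton_iff)
    then show ?thesis using less.prems(1) by (metis fun_upd_triv singletonI)
  next
    case False
    then have "\<not> card (A i) \<le> 1" using \<open>1 \<le> card (A i)\<close> by simp
    then obtain x1 x2 where x: "x1 \<in> A i" "x2 \<in> A i" "x1 \<noteq> x2"
      using less.prems(2)[of i] by (metis One_nat_def card_le_Suc0_iff_eq)
    then obtain x where "x \<in> A i" and h: "hall_condition (A(i := A i - {x}))"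
      using hall_condition_remove[OF less.prems x(3)] by metis
    let ?A = "A(i := A i - {x})"
    have "card (?A i) < card (A i)" using \<open>x \<in> A i\<close> less.prems(2)
      by (simp add: card_Diff1_less del: card_Diff_insert)
    moreover have "finite (?A j)" for j using less.prems(2) by simp
    ultimately obtain y where "y \<in> ?A i" "hall_condition (?A(i := {y}))"
      using less.hyps h by blast
    then show ?thesis by auto
  qed
qed

text \<open>The members are shrunk to singletons one index after the other. As they only decrease,
  the choice at \<open>i\<close> is final from stage \<open>Suc i\<close> on, and Hall's condition
  at a later stage separates any two choices.\<close>

lemma hall_matching_nat:
  fixes A :: "nat \<Rightarrow> 'b set"
  assumes "hall_condition A" and "\<And>i. finite (A i)"
  shows "\<exists>f. inj f \<and> (\<forall>i. f i \<in> A i)"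
proof -
  let ?P = "\<lambda>n B. hall_condition B \<and> (\<forall>i. finite (B i)) \<and> (\<forall>i. B i \<subseteq> A i) \<and> (\<forall>i<n. \<exists>x. B i = {x})"
  let ?Q = "\<lambda>n B B'. \<forall>i. B' i \<subseteq> (B i :: 'b set)"
  have "\<exists>B. \<forall>n. ?P n (B n) \<and> ?Q n (B n) (B (Suc n))"
  proof (rule dependent_nat_choice)
    show "\<exists>B. ?P 0 B" using assms by auto
    fix B n assume B: "?P n B"
    then obtain x where x: "x \<in> B n" "hall_condition (B(n := {x}))"
      using hall_condition_singleton by metis
    show "\<exists>B'. ?P (Suc n) B' \<and> ?Q n B B'"
      using B x by (intro exI[of _ "B(n := {x})"]) (auto simp: less_Suc_eq)
  qed
  then obtain B where B: "\<And>n. ?P n (B n)" "\<And>n. ?Q n (B n) (B (Suc n))" by metis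
  have dec: "B m i \<subseteq> B n i" if "n \<le> m" for n m i
    using lift_Suc_antimono_le[of "\<lambda>k. B k i"] B(2) that by blast
  have "\<exists>x. B (Suc i) i = {x}" for i using B(1)[of "Suc i"] by blast
  then have "\<exists>f. \<forall>i. B (Suc i) i = {f i}" by (intro choice allI)
  then obtain f where f: "\<And>i. B (Suc i) i = {f i}" by blast
  have later: "B n i = {f i}" if "i < n" for i n
  proof -
    obtain z where z: "B n i = {z}" using B(1)[of n] \<open>i < n\<close> by blast
    have "B n i \<subseteq> B (Suc i) i" using dec[of "Suc i" n i] \<open>i < n\<close> by simp
    then show ?thesis using f z by simp
  qed
  have "inj f"
  proof (rule injI)
    fix i j assume eq: "f i = f j"
    let ?n = "Suc (max i j)"
    have "card {i, j} \<le> card (\<Union>(B ?n ` {i, j}))"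
      using B(1)[of ?n] by (intro hall_conditionD) auto
    also have "\<dots> = 1" using later[of i ?n] later[of j ?n] eq by simp
    finally show "i = j" by (cases "i = j") auto
  qed
  moreover have "f i \<in> A i" for i using f[of i] B(1)[of "Suc i"] by blast
  ultimately show ?thesis by blast
qed

lemma hall_matching:
  assumes "countable I" "infinite I" and fin: "\<And>i. i \<in> I \<Longrightarrow> finite (A i)"
    and hall: "\<And>J. finite J \<Longrightarrow> J \<subseteq> I \<Longrightarrow> card J \<le> card (\<Union>(A ` J))"
  shows "\<exists>f. inj_on f I \<and> (\<forall>i\<in>I. f i \<in> A i)"
proof -
  let ?e = "from_nat_into I"
  have e: "bij_betw ?e UNIV I" using assms(1,2) by (rule bij_betw_from_nat_into)
  then have inj: "inj ?e" and range: "range ?e = I" by (auto simp: bij_betw_def)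
  have "hall_condition (A \<circ> ?e)"
    unfolding hall_condition_def
  proof (intro allI impI)
    fix J :: "nat set" assume "finite J"
    then have "card (?e ` J) \<le> card (\<Union>(A ` ?e ` J))" using range by (intro hall) auto
    then show "card J \<le> card (\<Union>((A \<circ> ?e) ` J))"
      using card_image[OF inj_on_subset[OF inj subset_UNIV], of J] by (simp add: image_comp)
  qed
  then obtain f where f: "inj f" "\<And>n. f n \<in> A (?e n)"
    using hall_matching_nat[of "A \<circ> ?e"] fin range by fastforce
  let ?f = "f \<circ> to_nat_on I"
  have "inj_on ?f I" using assms(1) f(1) by (meson comp_inj_on inj_on_subset inj_on_to_nat_on subset_UNIV)
  moreover have "?f i \<in> A i" if "i \<in> I" for i using f(2)[of "to_nat_on I i"] assms(1) that by simp
  ultimately show ?thesis by blast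
qed

section \<open>Finitely additive probabilities and Folner sets of amenable groups\<close>

lemma fin_additive_probD:
  assumes "fin_additive_prob X \<mu>"
  shows "A \<subseteq> X \<Longrightarrow> 0 \<le> \<mu> A" "\<mu> X = 1"
    "A \<subseteq> X \<Longrightarrow> B \<subseteq> X \<Longrightarrow> A \<inter> B = {} \<Longrightarrow> \<mu> (A \<union> B) = \<mu> A + \<mu> B"
  using assms by (simp_all add: fin_additive_prob_def)

lemma fin_additive_prob_empty:
  assumes "fin_additive_prob X \<mu>"
  shows "\<mu> {} = 0"
proof -
  have "\<mu> ({} \<union> {}) = \<mu> {} + \<mu> {}" by (intro fin_additive_probD(3)[OF assms]) auto
  then show ?thesis by simp
qed

lemma fin_additive_prob_UN:
  assumes mu: "fin_additive_prob X \<mu>" and "finite I" "\<And>i. i \<in> I \<Longrightarrow> A i \<subseteq> X"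
    "disjoint_family_on A I"
  shows "\<mu> (\<Union>i\<in>I. A i) = (\<Sum>i\<in>I. \<mu> (A i))"
  using assms(2-4)
proof (induction)
  case empty
  then show ?case using fin_additive_prob_empty[OF mu] by simp
next
  case (insert j I)
  have "A j \<inter> (\<Union>i\<in>I. A i) = {}" using insert.hyps insert.prems(2)
    by (auto simp: disjoint_family_on_def)
  moreover have "disjoint_family_on A I" using insert.prems(2)
    by (rule disjoint_family_on_mono[rotated]) auto
  moreover have "A j \<subseteq> X" "(\<Union>i\<in>I. A i) \<subseteq> X" using insert.prems(1) by auto
  ultimately show ?case using insert fin_additive_probD(3)[OF mu, of "A j" "\<Union>i\<in>I. A i"] by simp
qed

lemma fin_additive_prob_le_one:
  assumes mu: "fin_additive_prob X \<mu>" and "A \<subseteq> X"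
  shows "\<mu> A \<le> 1"
proof -
  have "\<mu> (A \<union> (X - A)) = \<mu> A + \<mu> (X - A)"
    by (intro fin_additive_probD(3)[OF mu] assms(2)) auto
  moreover have "0 \<le> \<mu> (X - A)" by (intro fin_additive_probD(1)[OF mu]) auto
  moreover have "A \<union> (X - A) = X" using assms(2) by blast
  ultimately show ?thesis using fin_additive_probD(2)[OF mu] by simp
qed

text \<open>Two injections of \<open>X\<close> into itself with disjoint images that are piecewise given by
  \<open>\<mu>\<close>-preserving maps would give \<open>X\<close> measure at least 2.\<close>

lemma fin_additive_prob_piecewise_image:
  assumes mu: "fin_additive_prob X \<mu>" and "finite L"
    and inv: "\<And>l A. l \<in> L \<Longrightarrow> A \<subseteq> X \<Longrightarrow> \<mu> (t l ` A) = \<mu> A"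
    and t: "\<And>l. l \<in> L \<Longrightarrow> t l ` X \<subseteq> X"
    and inj: "inj_on f X" and piece: "\<And>x. x \<in> X \<Longrightarrow> \<exists>l\<in>L. f x = t l x"
  shows "\<mu> (f ` X) = 1"
proof -
  obtain c where c: "\<And>x. x \<in> X \<Longrightarrow> c x \<in> L \<and> f x = t (c x) x" using piece by metis
  define A where "A = (\<lambda>l. {x \<in> X. c x = l})"
  have disj: "disjoint_family_on A L" by (auto simp: A_def disjoint_family_on_def)
  have disj': "disjoint_family_on (\<lambda>l. f ` A l) L"
    using inj by (fastforce simp: A_def disjoint_family_on_def inj_on_def)
  have img: "f ` A l = t l ` A l" for l using c by (force simp: A_def)
  have sub: "A l \<subseteq> X" for l by (auto simp: A_def)
  have X: "X = (\<Union>l\<in>L. A l)" using c by (auto simp: A_def)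
  have fX: "f ` X = (\<Union>l\<in>L. f ` A l)" using c by (auto simp: A_def)
  have sub': "f ` A l \<subseteq> X" if "l \<in> L" for l using t[OF that] sub[of l] img by blast
  have "\<mu> (f ` X) = (\<Sum>l\<in>L. \<mu> (f ` A l))"
    unfolding fX by (rule fin_additive_prob_UN[OF mu \<open>finite L\<close> sub' disj'])
  also have "\<dots> = (\<Sum>l\<in>L. \<mu> (A l))"
    by (rule sum.cong) (use img inv sub in auto)
  also have "\<dots> = \<mu> X"
    using fin_additive_prob_UN[OF mu \<open>finite L\<close> sub disj] X by simp
  also have "\<dots> = 1" by (rule fin_additive_probD(2)[OF mu])
  finally show ?thesis .
qed

text \<open>Iteration amplifies expansion: translating the set \<open>L C\<close> by
  \<open>K\<close> multiplies the factor by \<open>r\<close> once more, and the products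
  \<open>k \<otimes> l\<close> are the new translating elements. This pushes a factor just above 1
  past any bound.\<close>

lemma (in group) expanding_translates:
  assumes "finite K" "K \<subseteq> carrier G"
    and exp: "\<And>C. finite C \<Longrightarrow> C \<subseteq> carrier G \<Longrightarrow> r * real (card C) \<le> card (\<Union>k\<in>K. (\<otimes>) k ` C)"
    and "0 \<le> r"
  shows "\<exists>L. finite L \<and> L \<subseteq> carrier G \<and>
    (\<forall>C. finite C \<longrightarrow> C \<subseteq> carrier G \<longrightarrow> r ^ m * real (card C) \<le> card (\<Union>l\<in>L. (\<otimes>) l ` C))"
proof (induction m)
  case 0
  have "(\<Union>l\<in>{\<one>}. (\<otimes>) l ` C) = C" if "C \<subseteq> carrier G" for C
    using that by (force simp: image_iff)
  then show ?case by (intro exI[of _ "{\<one>}"]) auto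
next
  case (Suc m)
  then obtain L where L: "finite L" "L \<subseteq> carrier G"
    "\<And>C. finite C \<Longrightarrow> C \<subseteq> carrier G \<Longrightarrow> r ^ m * real (card C) \<le> card (\<Union>l\<in>L. (\<otimes>) l ` C)"
    by blast
  let ?L = "(\<lambda>(k, l). k \<otimes> l) ` (K \<times> L)"
  have "r ^ Suc m * real (card C) \<le> card (\<Union>l\<in>?L. (\<otimes>) l ` C)"
    if C: "finite C" "C \<subseteq> carrier G" for C
  proof -
    let ?D = "\<Union>l\<in>L. (\<otimes>) l ` C"
    have D: "finite ?D" "?D \<subseteq> carrier G" using L C by (auto simp: subset_iff)
    have "(\<Union>l\<in>?L. (\<otimes>) l ` C) = (\<Union>k\<in>K. (\<otimes>) k ` ?D)"
      using assms(2) L(2) C(2) m_assoc by (auto simp: image_iff subset_iff) metis+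
    moreover have "r * (r ^ m * real (card C)) \<le> r * card ?D"
      using L(3)[OF C] \<open>0 \<le> r\<close> by (rule mult_left_mono)
    ultimately show ?thesis using exp[OF D] by (simp add: mult.assoc)
  qed
  moreover have "finite ?L" "?L \<subseteq> carrier G" using assms(1,2) L by auto
  ultimately show ?case by blast
qed

text \<open>Without such a set, finitely many translates would expand every finite set at least
  twofold. Hall's theorem then gives two injections with disjoint images, piecewise left
  translations, which contradicts an invariant mean.\<close>

lemma (in group) amenable_group_folner:
  assumes am: "amenable_group G" and "countable (carrier G)" "infinite (carrier G)"
    and K: "finite K" "K \<subseteq> carrier G" and "0 < (e :: real)"
  shows "\<exists>C. finite C \<and> C \<noteq> {} \<and> C \<subseteq> carrier G \<and>
    (\<forall>k\<in>K. real (card ((\<otimes>) k ` C - C)) \<le> e * card C)"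
proof (rule ccontr)
  assume neg: "\<not> ?thesis"
  \<comment> \<open>\<open>\<one>\<close> is added to \<open>K\<close> so that the translates
    contain \<open>C\<close> itself besides the more than \<open>e * card C\<close> points of
    \<open>k C\<close> outside \<open>C\<close>.\<close>
  have "(1 + e) * real (card C) \<le> card (\<Union>k\<in>insert \<one> K. (\<otimes>) k ` C)"
    if C: "finite C" "C \<subseteq> carrier G" for C
  proof (cases "C = {}")
    case False
    then obtain k where k: "k \<in> K" "e * card C < real (card ((\<otimes>) k ` C - C))"
      using neg C by (meson not_le)
    have "C = (\<otimes>) \<one> ` C" using C(2) by (force simp: image_iff)
    then have "C \<union> ((\<otimes>) k ` C - C) \<subseteq> (\<Union>k\<in>insert \<one> K. (\<otimes>) k ` C)" using k(1) by blast
    then have "card (C \<union> ((\<otimes>) k ` C - C)) \<le> card (\<Union>k\<in>insert \<one> K. (\<otimes>) k ` C)"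
      using C(1) K(1) by (intro card_mono) auto
    moreover have "card (C \<union> ((\<otimes>) k ` C - C)) = card C + card ((\<otimes>) k ` C - C)"
      using C(1) by (intro card_Un_disjoint) auto
    ultimately show ?thesis using k(2) by (simp add: algebra_simps)
  qed simp
  then have exp: "\<exists>L. finite L \<and> L \<subseteq> carrier G \<and> (\<forall>C. finite C \<longrightarrow> C \<subseteq> carrier G \<longrightarrow>
      (1 + e) ^ m * real (card C) \<le> card (\<Union>l\<in>L. (\<otimes>) l ` C))" for m
    using K \<open>0 < e\<close> by (intro expanding_translates[of "insert \<one> K"]) auto
  obtain m where m: "2 < (1 + e) ^ m" using real_arch_pow[of "1 + e" 2] \<open>0 < e\<close> by auto
  obtain L where L: "finite L" "L \<subseteq> carrier G" and
    L2: "\<And>C. finite C \<Longrightarrow> C \<subseteq> carrier G \<Longrightarrow> (1 + e) ^ m * real (card C) \<le> card (\<Union>l\<in>L. (\<otimes>) l ` C)"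
    using exp[of m] by blast
  \<comment> \<open>The Boolean distinguishes two copies of each element, which is why the expansion
    factor had to exceed 2. Both copies have the same candidates \<open>l \<otimes> x\<close>, and
    injectivity on the pairs makes the two resulting maps injective with disjoint images.\<close>
  let ?I = "carrier G \<times> (UNIV :: bool set)"
  let ?A = "\<lambda>(x, b). (\<lambda>l. l \<otimes> x) ` L"
  have "\<exists>f. inj_on f ?I \<and> (\<forall>i\<in>?I. f i \<in> ?A i)"
  proof (rule hall_matching)
    show "infinite ?I" using assms(3) by (metis UNIV_not_empty finite_cartesian_productD1)
    fix J assume J: "finite J" "J \<subseteq> ?I"
    let ?C = "fst ` J"
    have C: "finite ?C" "?C \<subseteq> carrier G" using J by auto
    have "J \<subseteq> ?C \<times> UNIV" by force
    then have "card J \<le> card (?C \<times> (UNIV :: bool set))" using C(1) by (intro card_mono) auto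
    also have "\<dots> = 2 * card ?C" by (simp add: card_cartesian_product)
    finally have "real (card J) \<le> 2 * real (card ?C)" by simp
    also have "\<dots> \<le> (1 + e) ^ m * real (card ?C)" using m by (intro mult_right_mono) auto
    also have "\<dots> \<le> card (\<Union>l\<in>L. (\<otimes>) l ` ?C)" by (rule L2[OF C])
    also have "(\<Union>l\<in>L. (\<otimes>) l ` ?C) = \<Union>(?A ` J)" by force
    finally show "card J \<le> card (\<Union>(?A ` J))" by simp
  qed (use assms(2) L in auto)
  then obtain f where f: "inj_on f ?I" "\<And>x b. x \<in> carrier G \<Longrightarrow> f (x, b) \<in> (\<lambda>l. l \<otimes> x) ` L" by force
  obtain \<mu> where mu: "fin_additive_prob (carrier G) \<mu>"
    and inv: "\<And>g A. g \<in> carrier G \<Longrightarrow> A \<subseteq> carrier G \<Longrightarrow> \<mu> ((\<otimes>) g ` A) = \<mu> A"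
    using am unfolding amenable_group_def amenable_action_def by blast
  have one: "\<mu> ((\<lambda>x. f (x, b)) ` carrier G) = 1" for b
  proof (rule fin_additive_prob_piecewise_image[OF mu L(1), where t = "(\<otimes>)"])
    show "inj_on (\<lambda>x. f (x, b)) (carrier G)" using f(1) by (auto simp: inj_on_def)
    show "\<exists>l\<in>L. f (x, b) = l \<otimes> x" if "x \<in> carrier G" for x using f(2)[OF that, of b] by blast
  qed (use L(2) inv in auto)
  let ?F = "\<lambda>b. (\<lambda>x. f (x, b)) ` carrier G"
  have sub: "?F b \<subseteq> carrier G" for b
  proof
    fix y assume "y \<in> ?F b"
    then obtain x where x: "x \<in> carrier G" "y = f (x, b)" by blast
    then show "y \<in> carrier G" using f(2)[OF x(1), of b] L(2) by auto
  qed
  have "f (x, True) \<noteq> f (x', False)" if "x \<in> carrier G" "x' \<in> carrier G" for x x'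
    using inj_onD[OF f(1), of "(x, True)" "(x', False)"] that by auto
  then have "?F True \<inter> ?F False = {}" by blast
  then have "\<mu> (?F True \<union> ?F False) = \<mu> (?F True) + \<mu> (?F False)"
    by (intro fin_additive_probD(3)[OF mu] sub)
  then show False using one fin_additive_prob_le_one[OF mu, of "?F True \<union> ?F False"] sub by simp
qed

section \<open>Invariant means as cluster points of densities in Folner sets\<close>

lemma card_image_diff_inter:
  assumes "bij f" "finite C"
  shows "\<bar>real (card (f ` A \<inter> C)) - real (card (A \<inter> C))\<bar> \<le> card (f ` C - C)"
proof -
  have fin: "finite (f ` C - C)" "finite (f ` C)" using assms(2) by auto
  have inj: "inj f" using assms(1) by (rule bij_is_inj)
  \<comment> \<open>\<open>C\<close> and its image have the same finite size, so what the image
    loses equals what it gains; this makes the estimate symmetric.\<close>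
  have out: "card (C - f ` C) = card (f ` C - C)"
  proof -
    have "card C = card (C \<inter> f ` C) + card (C - f ` C)"
      using assms(2) by (simp add: card_Int_Diff)
    moreover have "card (f ` C) = card (C \<inter> f ` C) + card (f ` C - C)"
      using fin(2) by (metis card_Int_Diff Int_commute)
    moreover have "card (f ` C) = card C" by (rule card_image[OF inj_on_subset[OF inj subset_UNIV]])
    ultimately show ?thesis by simp
  qed
  have eq: "card (f ` A \<inter> f ` C) = card (A \<inter> C)"
    using card_image[OF inj_on_subset[OF inj subset_UNIV], of "A \<inter> C"] image_Int[OF inj] by metis
  have "card (f ` A \<inter> C) \<le> card ((f ` A \<inter> f ` C) \<union> (C - f ` C))"
    using assms(2) by (intro card_mono) auto
  also have "\<dots> \<le> card (A \<inter> C) + card (f ` C - C)"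
    using card_Un_le[of "f ` A \<inter> f ` C" "C - f ` C"] eq out by simp
  finally have 1: "card (f ` A \<inter> C) \<le> card (A \<inter> C) + card (f ` C - C)" .
  have "card (f ` A \<inter> f ` C) \<le> card ((f ` A \<inter> C) \<union> (f ` C - C))"
    using assms(2) by (intro card_mono) auto
  also have "\<dots> \<le> card (f ` A \<inter> C) + card (f ` C - C)" by (rule card_Un_le)
  finally have "card (A \<inter> C) \<le> card (f ` A \<inter> C) + card (f ` C - C)" using eq by simp
  then show ?thesis using 1 by linarith
qed

lemma compact_unit_cube: "compact (PiE UNIV (\<lambda>_ :: 'i. {0..1 :: real}))"
proof -
  have "compactin (product_topology (\<lambda>_. euclidean) UNIV) (PiE UNIV (\<lambda>_ :: 'i. {0..1 :: real}))"
    by (subst compactin_PiE) auto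
  then show ?thesis by (simp add: euclidean_product_topology)
qed

text \<open>The densities in the sets \<open>C n\<close> are points of a compact cube with one
  coordinate for each subset, and any cluster point is an invariant mean: each required identity
  says that a continuous functional vanishes, and along the sequence this functional tends to
  0.\<close>

lemma invariant_mean_from_folner:
  fixes C :: "nat \<Rightarrow> 'x set" and P :: "('x \<Rightarrow> 'x) set"
  assumes C: "\<And>n. finite (C n)" "\<And>n. C n \<noteq> {}" and P: "\<And>f. f \<in> P \<Longrightarrow> bij f"
    and folner: "\<And>f. f \<in> P \<Longrightarrow> (\<lambda>n. card (f ` C n - C n) / card (C n)) \<longlonglongrightarrow> 0"
  shows "\<exists>\<mu>. fin_additive_prob UNIV \<mu> \<and> (\<forall>f\<in>P. \<forall>A. \<mu> (f ` A) = \<mu> A)"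
proof -
  define m :: "nat \<Rightarrow> 'x set \<Rightarrow> real" where "m = (\<lambda>n A. card (A \<inter> C n) / card (C n))"
  have pos: "0 < card (C n)" "card (C n) \<noteq> 0" for n using C by (simp_all add: card_gt_0_iff)
  have "m n \<in> PiE UNIV (\<lambda>_. {0..1})" for n
    using C(1) pos card_mono[OF C(1) Int_lower2] by (auto simp: m_def divide_le_eq_1)
  then have "\<forall>F. F = filtermap m sequentially \<longrightarrow> F \<noteq> bot \<and> eventually (\<lambda>\<nu>. \<nu> \<in> PiE UNIV (\<lambda>_. {0..1})) F"
    by (auto simp: eventually_filtermap filtermap_bot_iff)
  then obtain \<mu> where cube: "\<mu> \<in> PiE UNIV (\<lambda>_. {0..1})"
    and cluster: "inf (nhds \<mu>) (filtermap m sequentially) \<noteq> bot"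
    using compact_unit_cube unfolding compact_filter by metis
  \<comment> \<open>The cube need not be sequentially compact, so limits are taken along the proper
    filter that refines both the neighbourhoods of \<open>\<mu>\<close> and the tails of
    \<open>m\<close>. Both limits of \<open>L\<close> hold there and must agree.\<close>
  have lim: "L \<mu> = 0" if cont: "continuous_on UNIV L" and null: "(\<lambda>n. L (m n)) \<longlonglongrightarrow> 0"
    for L :: "('x set \<Rightarrow> real) \<Rightarrow> real"
  proof (rule tendsto_unique[OF cluster])
    have "(L \<longlongrightarrow> L \<mu>) (nhds \<mu>)" using cont by (simp add: continuous_on_def tendsto_at_iff_tendsto_nhds)
    then show "(L \<longlongrightarrow> L \<mu>) (inf (nhds \<mu>) (filtermap m sequentially))"
      by (rule tendsto_mono[rotated]) simp
    have "(L \<longlongrightarrow> 0) (filtermap m sequentially)" using null by (simp add: filterlim_def filtermap_filtermap)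
    then show "(L \<longlongrightarrow> 0) (inf (nhds \<mu>) (filtermap m sequentially))"
      by (rule tendsto_mono[rotated]) simp
  qed
  have coord: "continuous_on UNIV (\<lambda>\<nu> :: 'x set \<Rightarrow> real. \<nu> A)" for A
    by (rule continuous_on_product_coordinates)
  have "m n UNIV = 1" for n using pos(2)[of n] by (simp add: m_def)
  then have "\<mu> UNIV - 1 = 0"
    by (intro lim[of "\<lambda>\<nu>. \<nu> UNIV - 1"] continuous_intros coord) simp
  moreover have "\<mu> (A \<union> B) - \<mu> A - \<mu> B = 0" if "A \<inter> B = {}" for A B
  proof (rule lim[of "\<lambda>\<nu>. \<nu> (A \<union> B) - \<nu> A - \<nu> B"])
    have "card ((A \<union> B) \<inter> C n) = card (A \<inter> C n) + card (B \<inter> C n)" for n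
      unfolding Int_Un_distrib2 using that C(1) by (intro card_Un_disjoint) auto
    then have "m n (A \<union> B) - m n A - m n B = 0" for n by (simp add: m_def add_divide_distrib)
    then show "(\<lambda>n. m n (A \<union> B) - m n A - m n B) \<longlonglongrightarrow> 0" by simp
  qed (intro continuous_intros coord)
  moreover have "\<mu> (f ` A) - \<mu> A = 0" if f: "f \<in> P" for f A
  proof (rule lim[of "\<lambda>\<nu>. \<nu> (f ` A) - \<nu> A"])
    have "\<bar>m n (f ` A) - m n A\<bar> \<le> card (f ` C n - C n) / card (C n)" for n
      using card_image_diff_inter[OF P[OF f] C(1), of A n] pos(1)[of n]
      by (simp add: m_def flip: diff_divide_distrib) (simp add: divide_right_mono abs_divide)
    then show "(\<lambda>n. m n (f ` A) - m n A) \<longlonglongrightarrow> 0"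
      by (intro tendsto_0_le[OF folner[OF f], where K = 1]) simp
  qed (intro continuous_intros coord)
  ultimately have "fin_additive_prob UNIV \<mu>" "\<forall>f\<in>P. \<forall>A. \<mu> (f ` A) = \<mu> A"
    using cube by (auto simp: fin_additive_prob_def PiE_def Pi_def algebra_simps)
  then show ?thesis by blast
qed

section \<open>Free actions with a highly core-free subgroup\<close>

lemma highly_core_free_infinite_index:
  assumes "group H" "infinite (carrier H)" "highly_core_free H \<Sigma>" "finite F" "F \<subseteq> carrier H"
  shows "\<not> carrier H \<subseteq> \<Sigma> <#>\<^bsub>H\<^esub> F"
proof
  interpret group H by fact
  assume cover: "carrier H \<subseteq> \<Sigma> <#>\<^bsub>H\<^esub> F"
  have sub: "subgroup \<Sigma> H" using assms(3) by (simp add: highly_core_free_def)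
  \<comment> \<open>The single set \<open>{\<one>}\<close> is admissible because nothing is left to
    be covered, and its core is \<open>\<Sigma>\<close> itself. Hence \<open>\<Sigma>\<close> is
    trivial and the finite set \<open>F\<close> would cover the group.\<close>
  have "\<exists>k\<in>{1..1::nat}. Core H {\<one>\<^bsub>H\<^esub>} \<Sigma> = {\<one>\<^bsub>H\<^esub>}"
    using assms(3-5) cover unfolding highly_core_free_def
    by (elim conjE allE[of _ F] allE[of _ "1::nat"] allE[of _ "\<lambda>_. {\<one>\<^bsub>H\<^esub>}"]) auto
  moreover have "Core H {\<one>\<^bsub>H\<^esub>} \<Sigma> = \<Sigma>"
    using subgroup.subset[OF sub] by (simp add: Core_def coset_mult_one lcos_mult_one)
  ultimately have "\<Sigma> = {\<one>\<^bsub>H\<^esub>}" by simp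
  then have "\<Sigma> <#>\<^bsub>H\<^esub> F \<subseteq> F" using assms(5) by (auto simp: set_mult_def)
  then have "carrier H \<subseteq> F" using cover by (rule order_trans[rotated])
  then have "finite (carrier H)" using assms(4) by (rule finite_subset)
  then show False using assms(2) by simp
qed

text \<open>Re-indexing by an arbitrary finite set, so that pairs of points can serve as indices
  later on.\<close>

lemma highly_core_free_family:
  assumes hcf: "highly_core_free H \<Sigma>" and F: "finite F" "F \<subseteq> carrier H"
    and I: "finite I" "I \<noteq> {}"
    and U: "\<And>j. j \<in> I \<Longrightarrow> U j \<noteq> {} \<and> U j \<subseteq> carrier H"
    and cover: "carrier H - (\<Sigma> <#>\<^bsub>H\<^esub> F) \<subseteq> (\<Union>j\<in>I. U j)"
  shows "\<exists>j\<in>I. Core H (U j) \<Sigma> = {\<one>\<^bsub>H\<^esub>}"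
proof -
  obtain e where e: "bij_betw e {1..card I} I"
    using ex_bij_betw_nat_finite_1[OF I(1)] by blast
  then have img: "e ` {1..card I} = I" by (simp add: bij_betw_def)
  have "1 \<le> card I" using I by (simp add: Suc_leI card_gt_0_iff)
  moreover have "\<forall>k\<in>{1..card I}. U (e k) \<noteq> {} \<and> U (e k) \<subseteq> carrier H" using U img by blast
  moreover have "carrier H - (\<Sigma> <#>\<^bsub>H\<^esub> F) \<subseteq> (\<Union>k\<in>{1..card I}. U (e k))"
    using cover img by (metis SUP_image comp_apply image_cong)
  ultimately have "\<exists>k\<in>{1..card I}. Core H (U (e k)) \<Sigma> = {\<one>\<^bsub>H\<^esub>}"
    using hcf F unfolding highly_core_free_def
    by (elim conjE allE[of _ F] allE[of _ "card I"] allE[of _ "\<lambda>k. U (e k)"]) simp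
  then show ?thesis using img by blast
qed

text \<open>A free action on a whole type in which \<open>orb\<close> numbers the orbits. That every
  number occurs provides infinitely many orbits, the room in which new points are found. The
  subgroup acts through \<open>i\<close>.\<close>

locale sub_action = group G for G :: "('a, 'm) monoid_scheme" (structure) +
  fixes S :: "('c, 'k) monoid_scheme" and i :: "'c \<Rightarrow> 'a"
    and \<alpha> :: "'a \<Rightarrow> 'x \<Rightarrow> 'x" and orb :: "'x \<Rightarrow> nat"
  assumes group_S: "group S" and mon: "i \<in> mon S G"
    and act_mult: "g \<in> carrier G \<Longrightarrow> h \<in> carrier G \<Longrightarrow> \<alpha> (g \<otimes> h) x = \<alpha> g (\<alpha> h x)"
    and act_one: "\<alpha> \<one> x = x"
    and act_free: "g \<in> carrier G \<Longrightarrow> \<alpha> g x = x \<Longrightarrow> g = \<one>"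
    and orb_eq: "orb x = orb x' \<longleftrightarrow> (\<exists>g\<in>carrier G. x' = \<alpha> g x)"
    and orb_surj: "\<exists>x. orb x = n"
begin

sublocale S: group S by (rule group_S)

lemma i_hom: "i \<in> hom S G" and i_inj: "inj_on i (carrier S)"
  using mon by (auto simp: mon_def)

lemma i_closed [simp]: "s \<in> carrier S \<Longrightarrow> i s \<in> carrier G"
  using i_hom by (rule hom_in_carrier)

lemma i_mult: "s \<in> carrier S \<Longrightarrow> t \<in> carrier S \<Longrightarrow> i (s \<otimes>\<^bsub>S\<^esub> t) = i s \<otimes> i t"
  using i_hom by (rule hom_mult)

lemma i_one [simp]: "i \<one>\<^bsub>S\<^esub> = \<one>"
  using i_hom group_S is_group by (rule hom_one)

lemma one_in_image: "\<one> \<in> i ` carrier S"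
  using i_one S.one_closed by (metis imageI)

lemma act_inv: "g \<in> carrier G \<Longrightarrow> \<alpha> (inv g) (\<alpha> g x) = x" "g \<in> carrier G \<Longrightarrow> \<alpha> g (\<alpha> (inv g) x) = x"
  using act_mult[of "inv g" g x] act_mult[of g "inv g" x] act_one by auto

lemma bij_act: "g \<in> carrier G \<Longrightarrow> bij (\<alpha> g)"
  by (rule o_bij[of "\<alpha> (inv g)"]) (auto simp: act_inv)

lemma act_cancel:
  assumes "g \<in> carrier G" "h \<in> carrier G" "\<alpha> g x = \<alpha> h x"
  shows "g = h"
proof -
  have "\<alpha> (inv h \<otimes> g) x = x" using assms act_mult act_inv by simp
  then have "inv h \<otimes> g = \<one>" using assms act_free by simp
  then show ?thesis using assms by (metis inv_closed inv_equality inv_inv)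
qed

lemma orb_act [simp]: "g \<in> carrier G \<Longrightarrow> orb (\<alpha> g x) = orb x"
  using orb_eq by metis

lemma sub_mult: "s \<in> carrier S \<Longrightarrow> t \<in> carrier S \<Longrightarrow> \<alpha> (i (s \<otimes>\<^bsub>S\<^esub> t)) x = \<alpha> (i s) (\<alpha> (i t) x)"
  by (simp add: i_mult act_mult)

lemma sub_one: "\<alpha> (i \<one>\<^bsub>S\<^esub>) x = x"
  by (simp add: act_one)

lemma sub_inv: "s \<in> carrier S \<Longrightarrow> \<alpha> (i (inv\<^bsub>S\<^esub> s)) (\<alpha> (i s) x) = x"
  "s \<in> carrier S \<Longrightarrow> \<alpha> (i s) (\<alpha> (i (inv\<^bsub>S\<^esub> s)) x) = x"
  using sub_mult[of "inv\<^bsub>S\<^esub> s" s x] sub_mult[of s "inv\<^bsub>S\<^esub> s" x] sub_one by auto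

lemma sub_cancel: "s \<in> carrier S \<Longrightarrow> t \<in> carrier S \<Longrightarrow> \<alpha> (i s) x = \<alpha> (i t) x \<Longrightarrow> s = t"
  using act_cancel i_inj by (metis i_closed inj_onD)

definition sat :: "'x set \<Rightarrow> 'x set" where
  "sat F = {\<alpha> (i s) x | s x. s \<in> carrier S \<and> x \<in> F}"

lemma satI: "s \<in> carrier S \<Longrightarrow> x \<in> F \<Longrightarrow> \<alpha> (i s) x \<in> sat F"
  by (auto simp: sat_def)

lemma sat_superset: "F \<subseteq> sat F"
  using satI[OF S.one_closed] sub_one by (metis subsetI)

lemma sat_mono: "F \<subseteq> F' \<Longrightarrow> sat F \<subseteq> sat F'"
  by (auto simp: sat_def)

lemma sat_Un: "sat (F \<union> F') = sat F \<union> sat F'"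
  by (auto simp: sat_def)

lemma sat_invariant: "s \<in> carrier S \<Longrightarrow> \<alpha> (i s) x \<in> sat F \<longleftrightarrow> x \<in> sat F"
proof
  assume s: "s \<in> carrier S"
  have closed: "\<alpha> (i t) y \<in> sat F" if "y \<in> sat F" "t \<in> carrier S" for t y
    using that sub_mult[of t] by (auto simp: sat_def) (metis S.m_closed)
  show "x \<in> sat F" if "\<alpha> (i s) x \<in> sat F"
    using closed[OF that, of "inv\<^bsub>S\<^esub> s"] s by (simp add: sub_inv)
  show "\<alpha> (i s) x \<in> sat F" if "x \<in> sat F" using closed[OF that s] .
qed

lemma orb_sat: "x \<in> sat F \<Longrightarrow> orb x \<in> orb ` F"
  by (auto simp: sat_def)

text \<open>A condition touches only finitely many orbits of the group, which \<open>N\<close>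
  records; points of other, pairwise different orbits can be added without conflict.\<close>

lemma fresh_points:
  assumes "finite N"
  shows "\<exists>z :: nat \<Rightarrow> 'x. (\<forall>k. orb (z k) \<notin> N) \<and> inj (orb \<circ> z)"
proof -
  obtain m where m: "\<forall>n\<in>N. n < m" using assms finite_nat_set_iff_bounded by blast
  have "\<forall>k. \<exists>x. orb x = m + k" using orb_surj by blast
  then obtain z where z: "\<And>k. orb (z k) = m + k" by metis
  then show ?thesis using m by (intro exI[of _ z]) (auto simp: inj_def)
qed

text \<open>For each pair \<open>x \<noteq> x'\<close> in one orbit, \<open>x' = \<alpha> c x\<close>, the elements \<open>g\<close> making \<open>g x\<close> and \<open>g x'\<close>
  equivalent modulo the subgroup conjugate \<open>c\<close> into it, so \<open>c\<close> lies in the core of this set.\<close>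

lemma move_apart:
  assumes hcf: "highly_core_free G (i ` carrier S)" and inf: "infinite (carrier G)"
    and fin: "finite A" "finite F"
  obtains g where "g \<in> carrier G" "\<forall>x\<in>A. \<alpha> g x \<notin> sat F"
    "\<forall>x\<in>A. \<forall>x'\<in>A. \<forall>s\<in>carrier S. \<alpha> (i s) (\<alpha> g x) = \<alpha> g x' \<longrightarrow> x = x'"
proof (rule ccontr)
  assume nt: "\<not> thesis"
  have neg: "\<not> (\<exists>g\<in>carrier G. (\<forall>x\<in>A. \<alpha> g x \<notin> sat F) \<and>
    (\<forall>x\<in>A. \<forall>x'\<in>A. \<forall>s\<in>carrier S. \<alpha> (i s) (\<alpha> g x) = \<alpha> g x' \<longrightarrow> x = x'))"
  proof (intro notI, elim bexE conjE)
    fix g assume "g \<in> carrier G" "\<forall>x\<in>A. \<alpha> g x \<notin> sat F"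
      "\<forall>x\<in>A. \<forall>x'\<in>A. \<forall>s\<in>carrier S. \<alpha> (i s) (\<alpha> g x) = \<alpha> g x' \<longrightarrow> x = x'"
    then have thesis by (rule that)
    then show False using nt by simp
  qed
  \<comment> \<open>By freeness only \<open>i s \<otimes> t (f, x)\<close> maps \<open>x\<close> to
    \<open>\<alpha> (i s) f\<close>. So all \<open>g\<close> that bring a point of \<open>A\<close>
    into \<open>sat F\<close> lie in finitely many cosets of the subgroup, the part that the
    definition allows to discard.\<close>
  let ?Q = "{(f, x). f \<in> F \<and> x \<in> A \<and> orb x = orb f}"
  have "\<forall>q\<in>?Q. \<exists>g\<in>carrier G. \<alpha> g (snd q) = fst q" using orb_eq by fastforce
  then obtain t where t: "\<And>f x. (f, x) \<in> ?Q \<Longrightarrow> t (f, x) \<in> carrier G \<and> \<alpha> (t (f, x)) x = f"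
    by (metis (no_types, lifting) fst_conv snd_conv)
  let ?F = "t ` ?Q"
  have "finite (F \<times> A)" using fin by simp
  then have Q: "finite ?Q" by (rule finite_subset[rotated]) auto
  have F: "finite ?F" "?F \<subseteq> carrier G" using Q t by auto
  let ?T = "\<lambda>(x, x'). {g \<in> carrier G. \<exists>s\<in>carrier S. \<alpha> (i s) (\<alpha> g x) = \<alpha> g x'}"
  \<comment> \<open>Pairs with empty \<open>?T\<close> are left out, as the definition of highly
    core-free asks for non-empty sets.\<close>
  let ?I = "{(x, x'). x \<in> A \<and> x' \<in> A \<and> x \<noteq> x' \<and> ?T (x, x') \<noteq> {}}"
  have "finite (A \<times> A)" using fin by simp
  then have I: "finite ?I" by (rule finite_subset[rotated]) auto
  have cover: "carrier G - (i ` carrier S <#> ?F) \<subseteq> (\<Union>j\<in>?I. ?T j)"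
  proof
    fix g assume g: "g \<in> carrier G - (i ` carrier S <#> ?F)"
    then have gG: "g \<in> carrier G" by simp
    have "\<alpha> g x \<notin> sat F" if x: "x \<in> A" for x
    proof
      assume "\<alpha> g x \<in> sat F"
      then obtain s f where s: "s \<in> carrier S" "f \<in> F" "\<alpha> g x = \<alpha> (i s) f" by (auto simp: sat_def)
      then have "orb f = orb x" using gG by (metis i_closed orb_act)
      then have q: "(f, x) \<in> ?Q" using s x by simp
      then have "\<alpha> g x = \<alpha> (i s \<otimes> t (f, x)) x" using s t[OF q] by (simp add: act_mult)
      then have "g = i s \<otimes> t (f, x)" using gG s t[OF q] by (auto intro: act_cancel)
      then have "g \<in> i ` carrier S <#> ?F" using s(1) q unfolding set_mult_def by blast
      then show False using g by simp
    qed
    then obtain x x' s where x: "x \<in> A" "x' \<in> A" "s \<in> carrier S" "\<alpha> (i s) (\<alpha> g x) = \<alpha> g x'" "x \<noteq> x'"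
      using neg gG by blast
    then have "g \<in> ?T (x, x')" using gG by blast
    then show "g \<in> (\<Union>j\<in>?I. ?T j)" using x by blast
  qed
  have "?I \<noteq> {}"
  proof
    assume "?I = {}"
    then have "carrier G \<subseteq> i ` carrier S <#> ?F" using cover by blast
    then show False using highly_core_free_infinite_index[OF is_group inf hcf F] by blast
  qed
  then have "\<exists>j\<in>?I. Core G (?T j) (i ` carrier S) = {\<one>}"
    by (intro highly_core_free_family[OF hcf F I _ _ cover]) auto
  then obtain x x' where x: "x \<in> A" "x' \<in> A" "x \<noteq> x'" "?T (x, x') \<noteq> {}"
    and core: "Core G (?T (x, x')) (i ` carrier S) = {\<one>}" by blast
  obtain g0 s0 where g0: "g0 \<in> carrier G" "s0 \<in> carrier S" "\<alpha> (i s0) (\<alpha> g0 x) = \<alpha> g0 x'"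
    using x(4) by auto
  have "orb x = orb x'" using g0 by (metis i_closed orb_act)
  then obtain c where c: "c \<in> carrier G" "x' = \<alpha> c x" using orb_eq by blast
  have "c \<in> inv g <# (i ` carrier S) #> g" if g: "g \<in> ?T (x, x')" for g
  proof -
    obtain s where s: "g \<in> carrier G" "s \<in> carrier S" "\<alpha> (i s) (\<alpha> g x) = \<alpha> g x'" using g by auto
    then have "\<alpha> (i s \<otimes> g) x = \<alpha> (g \<otimes> c) x" using c by (simp add: act_mult)
    then have eq: "i s \<otimes> g = g \<otimes> c" using s c by (auto intro: act_cancel)
    have "c = inv g \<otimes> (g \<otimes> c)" using s(1) c(1) by (simp flip: m_assoc)
    also have "\<dots> = inv g \<otimes> i s \<otimes> g" using s(1,2) by (simp add: m_assoc flip: eq)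
    finally show ?thesis using s(2) unfolding l_coset_def r_coset_def by blast
  qed
  then have "c \<in> Core G (?T (x, x')) (i ` carrier S)" unfolding Core_def by blast
  then have "c = \<one>" using core by blast
  then show False using c(2) x(3) act_one by simp
qed

lemma ex_not_in_sub:
  assumes "highly_core_free G (i ` carrier S)" "infinite (carrier G)"
  shows "\<exists>g\<in>carrier G. g \<notin> i ` carrier S"
  using highly_core_free_infinite_index[OF is_group assms(2,1), of "{\<one>}"]
  by (force simp: set_mult_def)

section \<open>Transversals and Folner sets in a free action\<close>

lemma sat_transversal:
  assumes "sat C = C"
  shows "\<exists>T\<subseteq>C. sat T = C \<and> (\<forall>x\<in>T. \<forall>x'\<in>T. \<forall>s\<in>carrier S. \<alpha> (i s) x = x' \<longrightarrow> x = x')"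
proof -
  \<comment> \<open>The choice depends on \<open>x\<close> only through \<open>sat {x}\<close>, so
    \<open>r\<close> is constant on each orbit of the subgroup and its values on \<open>C\<close>
    form a transversal.\<close>
  define r where "r = (\<lambda>x. SOME x'. x' \<in> sat {x})"
  have r: "r x \<in> sat {x}" for x unfolding r_def by (rule someI[of _ x]) (use sat_superset in blast)
  have sat_eq: "sat {\<alpha> (i s) x} = sat {x}" if s: "s \<in> carrier S" for s x
  proof
    show "sat {\<alpha> (i s) x} \<subseteq> sat {x}"
      using s by (auto simp: sat_def simp flip: sub_mult)
    show "sat {x} \<subseteq> sat {\<alpha> (i s) x}"
    proof
      fix y assume "y \<in> sat {x}"
      then obtain t where t: "t \<in> carrier S" "y = \<alpha> (i t) x" by (auto simp: sat_def)
      then have "y = \<alpha> (i (t \<otimes>\<^bsub>S\<^esub> inv\<^bsub>S\<^esub> s)) (\<alpha> (i s) x)" using s by (simp add: sub_mult sub_inv)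
      then show "y \<in> sat {\<alpha> (i s) x}" using s t by (auto intro: satI)
    qed
  qed
  have r_eq: "r (\<alpha> (i s) x) = r x" if "s \<in> carrier S" for s x
    using sat_eq[OF that] by (simp add: r_def)
  have rr: "r (r x) = r x" for x using r[of x] r_eq by (auto simp: sat_def)
  have rC: "r ` C \<subseteq> C" using r assms sat_mono by blast
  moreover have "C \<subseteq> sat (r ` C)"
  proof
    fix x assume x: "x \<in> C"
    obtain s where s: "s \<in> carrier S" "r x = \<alpha> (i s) x" using r[of x] by (auto simp: sat_def)
    then have "x = \<alpha> (i (inv\<^bsub>S\<^esub> s)) (r x)" by (simp add: sub_inv)
    then show "x \<in> sat (r ` C)" using s(1) x by (metis S.inv_closed imageI satI)
  qed
  moreover have "sat (r ` C) \<subseteq> C" using rC assms sat_mono by blast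
  moreover have "x = x'" if "x \<in> r ` C" "x' \<in> r ` C" "s \<in> carrier S" "\<alpha> (i s) x = x'" for x x' s
    using that r_eq rr by (metis imageE)
  ultimately show ?thesis by (intro exI[of _ "r ` C"]) blast
qed

lemma card_sat_transversal:
  assumes "\<forall>x\<in>T. \<forall>x'\<in>T. \<forall>s\<in>carrier S. \<alpha> (i s) x = x' \<longrightarrow> x = x'"
  shows "card (sat T) = card (carrier S) * card T"
proof -
  let ?f = "\<lambda>(s, x). \<alpha> (i s) x"
  have "inj_on ?f (carrier S \<times> T)"
  proof (rule inj_onI, clarify)
    fix s x t y assume h: "s \<in> carrier S" "x \<in> T" "t \<in> carrier S" "y \<in> T" "\<alpha> (i s) x = \<alpha> (i t) y"
    then have "\<alpha> (i (inv\<^bsub>S\<^esub> t \<otimes>\<^bsub>S\<^esub> s)) x = y" by (simp add: sub_mult sub_inv)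
    then have "x = y" using assms h by (metis S.inv_closed S.m_closed)
    then show "s = t \<and> x = y" using h sub_cancel by blast
  qed
  moreover have "sat T = ?f ` (carrier S \<times> T)" by (force simp: sat_def)
  ultimately show ?thesis by (simp add: card_image card_cartesian_product)
qed

text \<open>\<open>c\<close> is the size of a Folner set of the group that is invariant under the
  subgroup from the left, and \<open>C\<close> consists of \<open>q\<close> copies of it in fresh
  orbits. As \<open>c\<close> is fixed before \<open>q\<close>, sizes in two different groups can be
  made equal afterwards.\<close>

lemma folner_sets:
  assumes am: "amenable_group G" and inf: "countable (carrier G)" "infinite (carrier G)"
    and S: "finite (carrier S)" and K: "finite K" "K \<subseteq> carrier G" and e: "0 < (e :: real)"
  shows "\<exists>c>0. \<forall>q N. finite N \<longrightarrow> (\<exists>C. finite C \<and> card C = c * q \<and> sat C = C \<and>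
    orb ` C \<inter> N = {} \<and> (\<forall>k\<in>K. real (card (\<alpha> k ` C - C)) \<le> e * card C))"
proof -
  \<comment> \<open>The saturated set \<open>D\<close> leaves itself under \<open>k\<close> only
    through the sets \<open>k (i s) D0 - D0\<close>, one for each \<open>s\<close>. So
    \<open>D0\<close> is taken almost invariant under all \<open>k \<otimes> i s\<close>, up to the
    fraction \<open>e / card (carrier S)\<close>.\<close>
  let ?KS = "(\<lambda>(k, s). k \<otimes> i s) ` (K \<times> carrier S)"
  have cS: "0 < card (carrier S)" using S S.one_closed by (auto simp: card_gt_0_iff)
  have KS: "finite ?KS" "?KS \<subseteq> carrier G" using S K by auto
  have pos: "0 < e / card (carrier S)" using e cS by simp
  obtain D0 where D0: "finite D0" "D0 \<noteq> {}" "D0 \<subseteq> carrier G"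
    and D0_folner: "\<forall>k\<in>?KS. real (card ((\<otimes>) k ` D0 - D0)) \<le> e / card (carrier S) * card D0"
    using amenable_group_folner[OF am inf KS pos] by (elim exE conjE) (rule that)
  define D where "D = (\<lambda>(s, d). i s \<otimes> d) ` (carrier S \<times> D0)"
  have D: "finite D" "D \<subseteq> carrier G" using S D0 by (auto simp: D_def)
  have "D0 \<subseteq> D"
  proof
    fix d assume "d \<in> D0"
    then show "d \<in> D" using D0(3) unfolding D_def by (intro image_eqI[of _ _ "(\<one>\<^bsub>S\<^esub>, d)"]) auto
  qed
  then have card_D: "card D0 \<le> card D" "0 < card D"
    using D D0 by (auto simp: card_gt_0_iff intro: card_mono)
  have sD: "i s \<otimes> d \<in> D" if "s \<in> carrier S" "d \<in> D" for s d
  proof -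
    obtain t d0 where t: "t \<in> carrier S" "d0 \<in> D0" "d = i t \<otimes> d0" using \<open>d \<in> D\<close> by (auto simp: D_def)
    moreover from t have "d0 \<in> carrier G" using D0(3) by blast
    ultimately have "i s \<otimes> d = i (s \<otimes>\<^bsub>S\<^esub> t) \<otimes> d0" using that(1) by (simp add: i_mult m_assoc)
    then show ?thesis using that(1) t unfolding D_def by (intro image_eqI[of _ _ "(s \<otimes>\<^bsub>S\<^esub> t, d0)"]) auto
  qed
  have D_folner: "real (card ((\<otimes>) k ` D - D)) \<le> e * card D" if k: "k \<in> K" for k
  proof -
    have "(\<otimes>) k ` D - D \<subseteq> (\<Union>s\<in>carrier S. (\<otimes>) (k \<otimes> i s) ` D0 - D0)"
    proof
      fix x assume x: "x \<in> (\<otimes>) k ` D - D"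
      then obtain s d where s: "s \<in> carrier S" "d \<in> D0" "x = k \<otimes> (i s \<otimes> d)" by (auto simp: D_def)
      moreover have "k \<in> carrier G" "d \<in> carrier G" using s k K(2) D0(3) by auto
      ultimately have "x = (k \<otimes> i s) \<otimes> d" by (simp add: m_assoc)
      moreover have "x \<notin> D0" using x \<open>D0 \<subseteq> D\<close> by blast
      ultimately show "x \<in> (\<Union>s\<in>carrier S. (\<otimes>) (k \<otimes> i s) ` D0 - D0)" using s by blast
    qed
    then have "card ((\<otimes>) k ` D - D) \<le> card (\<Union>s\<in>carrier S. (\<otimes>) (k \<otimes> i s) ` D0 - D0)"
      using S D0(1) by (intro card_mono) auto
    also have "\<dots> \<le> (\<Sum>s\<in>carrier S. card ((\<otimes>) (k \<otimes> i s) ` D0 - D0))" by (rule card_UN_le[OF S])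
    finally have "real (card ((\<otimes>) k ` D - D)) \<le> (\<Sum>s\<in>carrier S. real (card ((\<otimes>) (k \<otimes> i s) ` D0 - D0)))"
      by (simp flip: of_nat_sum)
    also have "\<dots> \<le> (\<Sum>s\<in>carrier S. e / card (carrier S) * card D0)"
      using D0_folner k by (intro sum_mono) auto
    also have "\<dots> = e * card D0" using cS by simp
    also have "\<dots> \<le> e * card D" using card_D e by simp
    finally show ?thesis .
  qed
  have "\<exists>C. finite C \<and> card C = card D * q \<and> sat C = C \<and>
    orb ` C \<inter> N = {} \<and> (\<forall>k\<in>K. real (card (\<alpha> k ` C - C)) \<le> e * card C)" if N: "finite N" for q N
  proof -
    obtain z :: "nat \<Rightarrow> 'x" where z: "\<And>k. orb (z k) \<notin> N" "inj (orb \<circ> z)" using fresh_points[OF N] by blast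
    have zinj: "orb (z j) = orb (z k) \<longleftrightarrow> j = k" for j k using z(2) by (auto simp: inj_def)
    let ?f = "\<lambda>(g, j). \<alpha> g (z j)"
    have inj: "inj_on ?f (carrier G \<times> UNIV)"
    proof (rule inj_onI, clarify)
      fix g j h k assume gh: "g \<in> carrier G" "h \<in> carrier G" "\<alpha> g (z j) = \<alpha> h (z k)"
      then have "j = k" by (metis orb_act zinj)
      then show "g = h \<and> j = k" using gh act_cancel by blast
    qed
    \<comment> \<open>One copy of \<open>D\<close> in each of \<open>q\<close> orbits, placed by the
      orbit map of \<open>z j\<close>, which is injective because the action is free. The boundary
      is copied as well, so the Folner estimate is inherited.\<close>
    define C where "C = ?f ` (D \<times> {..<q})"
    have C: "finite C" "card C = card D * q"
      using D card_image[OF inj_on_subset[OF inj], of "D \<times> {..<q}"]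
      by (auto simp: C_def card_cartesian_product)
    have "sat C \<subseteq> C"
    proof
      fix x assume "x \<in> sat C"
      then obtain s d j where s: "s \<in> carrier S" "d \<in> D" "j < q" "x = \<alpha> (i s) (\<alpha> d (z j))"
        by (auto simp: sat_def C_def)
      moreover from s have "d \<in> carrier G" using D(2) by blast
      ultimately have "x = \<alpha> (i s \<otimes> d) (z j)" by (simp add: act_mult)
      then show "x \<in> C" using sD[OF s(1,2)] s(3) unfolding C_def by (intro image_eqI[of _ _ "(i s \<otimes> d, j)"]) auto
    qed
    then have "sat C = C" using sat_superset by blast
    moreover have "orb ` C \<inter> N = {}" using z(1) D(2) by (fastforce simp: C_def)
    moreover have "real (card (\<alpha> k ` C - C)) \<le> e * card C" if k: "k \<in> K" for k
    proof -
      have "\<alpha> k ` C - C \<subseteq> ?f ` (((\<otimes>) k ` D - D) \<times> {..<q})"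
      proof
        fix x assume x: "x \<in> \<alpha> k ` C - C"
        then obtain d j where d: "d \<in> D" "j < q" "x = \<alpha> k (\<alpha> d (z j))" by (auto simp: C_def)
        moreover have "k \<in> carrier G" "d \<in> carrier G" using d k K(2) D(2) by auto
        ultimately have eq: "x = \<alpha> (k \<otimes> d) (z j)" by (simp add: act_mult)
        then have "k \<otimes> d \<notin> D" using x d(2) unfolding C_def by (auto simp: image_iff)
        then show "x \<in> ?f ` (((\<otimes>) k ` D - D) \<times> {..<q})"
          using eq d by (intro image_eqI[of _ _ "(k \<otimes> d, j)"]) auto
      qed
      then have "card (\<alpha> k ` C - C) \<le> card (((\<otimes>) k ` D - D) \<times> {..<q})"
        using D(1) by (intro surj_card_le) auto
      then have "real (card (\<alpha> k ` C - C)) \<le> real (card ((\<otimes>) k ` D - D)) * q"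
        by (simp add: card_cartesian_product flip: of_nat_mult)
      also have "\<dots> \<le> e * card D * q" using D_folner[OF k] by (rule mult_right_mono) simp
      finally show ?thesis using C(2) by (simp add: mult.assoc)
    qed
    ultimately show ?thesis using C by blast
  qed
  then show ?thesis using card_D(2) by blast
qed

end

section \<open>Reduced words in amalgams\<close>

lemma coset_notin:
  assumes "group H" "subgroup K H" "k \<in> K" "x \<in> carrier H - K"
  shows "k \<otimes>\<^bsub>H\<^esub> x \<in> carrier H - K"
proof -
  interpret group H by fact
  have k: "k \<in> carrier H" using assms(2,3) subgroup.subset by blast
  have "x \<in> K" if "k \<otimes>\<^bsub>H\<^esub> x \<in> K"
  proof -
    have "inv\<^bsub>H\<^esub> k \<otimes>\<^bsub>H\<^esub> (k \<otimes>\<^bsub>H\<^esub> x) \<in> K"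
      using that assms(2,3) by (simp add: subgroup.m_closed subgroup.m_inv_closed)
    then show ?thesis using k assms(4) by (simp flip: m_assoc)
  qed
  then show ?thesis using k assms(4) by auto
qed

locale amalg_data = A: group G1 + B: group G2 + S: group S
  for G1 :: "('a, 'm) monoid_scheme" and G2 :: "('b, 'n) monoid_scheme"
    and S :: "('c, 'k) monoid_scheme" +
  fixes i1 :: "'c \<Rightarrow> 'a" and i2 :: "'c \<Rightarrow> 'b"
  assumes mon1: "i1 \<in> mon S G1" and mon2: "i2 \<in> mon S G2"
begin

lemma hom1: "i1 \<in> hom S G1" and hom2: "i2 \<in> hom S G2"
  using mon1 mon2 by (auto simp: mon_def)

abbreviation P :: "('a + 'b) list set monoid" where "P \<equiv> amalg G1 G2 S i1 i2"
abbreviation W :: "('a + 'b) list set" where "W \<equiv> amalg_words G1 G2"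
abbreviation cls :: "('a + 'b) list \<Rightarrow> ('a + 'b) list set" where "cls \<equiv> amalg_class G1 G2 S i1 i2"
abbreviation \<Sigma>1 :: "'a set" where "\<Sigma>1 \<equiv> i1 ` carrier S"
abbreviation \<Sigma>2 :: "'b set" where "\<Sigma>2 \<equiv> i2 ` carrier S"

sublocale P: group P
  using A.is_group B.is_group hom1 hom2 by (rule group_amalg)

lemma subgroup_image: "subgroup \<Sigma>1 G1" "subgroup \<Sigma>2 G2"
  using group_hom.img_is_subgroup hom1 hom2
  by (metis group_hom.intro group_hom_axioms.intro A.is_group B.is_group S.is_group)+

lemma carrier_P: "carrier P = cls ` W"
  by (simp add: amalg_def)

lemma cls_closed [simp]: "u \<in> W \<Longrightarrow> cls u \<in> carrier P"
  by (simp add: carrier_P)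

lemma one_P: "\<one>\<^bsub>P\<^esub> = cls []"
  by (simp add: amalg_def)

lemma letter_words: "x \<in> carrier G1 \<Longrightarrow> Inl x # u \<in> W \<longleftrightarrow> u \<in> W" "y \<in> carrier G2 \<Longrightarrow> Inr y # u \<in> W \<longleftrightarrow> u \<in> W"
  "[] \<in> W"
  by (auto simp: amalg_words_def)

definition inl :: "'a \<Rightarrow> ('a + 'b) list set" where "inl x = cls [Inl x]"
definition inr :: "'b \<Rightarrow> ('a + 'b) list set" where "inr y = cls [Inr y]"

lemma inl_hom: "inl \<in> hom G1 P" and inr_hom: "inr \<in> hom G2 P"
  and inl_inr: "s \<in> carrier S \<Longrightarrow> inl (i1 s) = inr (i2 s)"
  using amalg_cocone[OF A.is_group B.is_group hom1 hom2] by (simp_all add: inl_def[abs_def] inr_def[abs_def])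

lemma inl_closed [simp]: "x \<in> carrier G1 \<Longrightarrow> inl x \<in> carrier P"
  and inr_closed [simp]: "y \<in> carrier G2 \<Longrightarrow> inr y \<in> carrier P"
  using inl_hom inr_hom by (simp_all add: hom_in_carrier)

lemma inl_mult: "x \<in> carrier G1 \<Longrightarrow> x' \<in> carrier G1 \<Longrightarrow> inl (x \<otimes>\<^bsub>G1\<^esub> x') = inl x \<otimes>\<^bsub>P\<^esub> inl x'"
  and inr_mult: "y \<in> carrier G2 \<Longrightarrow> y' \<in> carrier G2 \<Longrightarrow> inr (y \<otimes>\<^bsub>G2\<^esub> y') = inr y \<otimes>\<^bsub>P\<^esub> inr y'"
  using inl_hom inr_hom by (simp_all add: hom_mult)

lemma inl_one: "inl \<one>\<^bsub>G1\<^esub> = \<one>\<^bsub>P\<^esub>"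
  by (rule hom_one[OF inl_hom A.is_group P.is_group])

lemma cls_Inl: "x \<in> carrier G1 \<Longrightarrow> u \<in> W \<Longrightarrow> cls (Inl x # u) = inl x \<otimes>\<^bsub>P\<^esub> cls u"
  and cls_Inr: "y \<in> carrier G2 \<Longrightarrow> u \<in> W \<Longrightarrow> cls (Inr y # u) = inr y \<otimes>\<^bsub>P\<^esub> cls u"
  by (simp_all add: inl_def inr_def amalg_mult_class letter_words)

fun reduced :: "('a + 'b) list \<Rightarrow> bool" where
  "reduced [] \<longleftrightarrow> True"
| "reduced (Inl g # u) \<longleftrightarrow> g \<in> carrier G1 - \<Sigma>1 \<and> (u = [] \<or> \<not> isl (hd u)) \<and> reduced u"
| "reduced (Inr h # u) \<longleftrightarrow> h \<in> carrier G2 - \<Sigma>2 \<and> (u = [] \<or> isl (hd u)) \<and> reduced u"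

lemma reduced_words: "reduced u \<Longrightarrow> u \<in> W"
  by (induction u rule: reduced.induct) (auto simp: letter_words)

text \<open>If \<open>v\<close> begins with a letter of the same factor, \<open>g\<close> is merged
  with it. The product then either lies in the subgroup and becomes the prefix \<open>i1 s\<close>,
  or is a legitimate first letter with trivial prefix.\<close>

lemma absorb_inl:
  assumes g: "g \<in> carrier G1" and v: "reduced v"
  shows "\<exists>s\<in>carrier S. \<exists>v'. reduced v' \<and> inl g \<otimes>\<^bsub>P\<^esub> cls v = inl (i1 s) \<otimes>\<^bsub>P\<^esub> cls v'"
proof -
  have new: ?thesis if "inl g \<otimes>\<^bsub>P\<^esub> cls v = inl x \<otimes>\<^bsub>P\<^esub> cls v'" "x \<in> carrier G1" "reduced v'" "v' = [] \<or> \<not> isl (hd v')"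
    for x v'
  proof (cases "x \<in> \<Sigma>1")
    case False
    then have "reduced (Inl x # v')" using that by simp
    moreover have "inl x \<otimes>\<^bsub>P\<^esub> cls v' = inl (i1 \<one>\<^bsub>S\<^esub>) \<otimes>\<^bsub>P\<^esub> cls (Inl x # v')"
      using that reduced_words hom_one[OF hom1 S.is_group A.is_group]
      by (simp add: cls_Inl inl_one)
    ultimately show ?thesis using that(1) S.one_closed by metis
  qed (use that in auto)
  show ?thesis
  proof (cases "v = [] \<or> \<not> isl (hd v)")
    case False
    then obtain g' v0 where v0: "v = Inl g' # v0" by (cases v; cases "hd v") auto
    then have "g' \<in> carrier G1" "v0 \<in> W" "reduced v0" "v0 = [] \<or> \<not> isl (hd v0)" using v reduced_words by auto
    then show ?thesis using g v0
      by (intro new[of "g \<otimes>\<^bsub>G1\<^esub> g'" v0]) (simp_all add: cls_Inl inl_mult P.m_assoc)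
  qed (use new[OF HOL.refl g v] in blast)
qed

text \<open>The mirror image of the preceding lemma, except that a subgroup element arising in the
  second factor is rewritten as \<open>inl (i1 s)\<close> by the identification of the two
  copies.\<close>

lemma absorb_inr:
  assumes h: "h \<in> carrier G2" and v: "reduced v"
  shows "\<exists>s\<in>carrier S. \<exists>v'. reduced v' \<and> inr h \<otimes>\<^bsub>P\<^esub> cls v = inl (i1 s) \<otimes>\<^bsub>P\<^esub> cls v'"
proof -
  have new: ?thesis if "inr h \<otimes>\<^bsub>P\<^esub> cls v = inr y \<otimes>\<^bsub>P\<^esub> cls v'" "y \<in> carrier G2" "reduced v'" "v' = [] \<or> isl (hd v')"
    for y v'
  proof (cases "y \<in> \<Sigma>2")
    case False
    then have "reduced (Inr y # v')" using that by simp
    moreover have "inr y \<otimes>\<^bsub>P\<^esub> cls v' = inl (i1 \<one>\<^bsub>S\<^esub>) \<otimes>\<^bsub>P\<^esub> cls (Inr y # v')"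
      using that reduced_words hom_one[OF hom1 S.is_group A.is_group]
      by (simp add: cls_Inr inl_one)
    ultimately show ?thesis using that(1) S.one_closed by metis
  qed (use that inl_inr in auto)
  show ?thesis
  proof (cases "v = [] \<or> isl (hd v)")
    case False
    then obtain h' v0 where v0: "v = Inr h' # v0" by (cases v; cases "hd v") auto
    then have "h' \<in> carrier G2" "v0 \<in> W" "reduced v0" "v0 = [] \<or> isl (hd v0)" using v reduced_words by auto
    then show ?thesis using h v0
      by (intro new[of "h \<otimes>\<^bsub>G2\<^esub> h'" v0]) (simp_all add: cls_Inr inr_mult P.m_assoc)
  qed (use new[OF HOL.refl h v] in blast)
qed

text \<open>Letters are added from the left. The subgroup prefix of the remaining word is first
  multiplied into the new letter, inside the factor of that letter, and the product is then
  absorbed.\<close>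

lemma normal_form:
  assumes "u \<in> W"
  shows "\<exists>s\<in>carrier S. \<exists>v. reduced v \<and> cls u = inl (i1 s) \<otimes>\<^bsub>P\<^esub> cls v"
  using assms
proof (induction u)
  case Nil
  have "cls [] = inl (i1 \<one>\<^bsub>S\<^esub>) \<otimes>\<^bsub>P\<^esub> cls []"
    using hom_one[OF hom1 S.is_group A.is_group] by (simp add: inl_one letter_words)
  then show ?case using S.one_closed by (intro bexI exI[of _ "[]"]) auto
next
  case (Cons a u)
  then have u: "u \<in> W" by (auto simp: amalg_words_def)
  then obtain s v where s: "s \<in> carrier S" "reduced v" "cls u = inl (i1 s) \<otimes>\<^bsub>P\<^esub> cls v"
    using Cons.IH by blast
  have i: "i1 s \<in> carrier G1" "i2 s \<in> carrier G2" using s(1) hom1 hom2 by (auto simp: hom_in_carrier)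
  have v: "v \<in> W" using s(2) by (rule reduced_words)
  show ?case
  proof (cases a)
    case (Inl g)
    then have g: "g \<in> carrier G1" using Cons.prems by (auto simp: amalg_words_def)
    then have "cls (a # u) = inl (g \<otimes>\<^bsub>G1\<^esub> i1 s) \<otimes>\<^bsub>P\<^esub> cls v"
      using u i v s(3) Inl by (simp add: cls_Inl inl_mult P.m_assoc)
    then show ?thesis using absorb_inl[OF _ s(2), of "g \<otimes>\<^bsub>G1\<^esub> i1 s"] g i by simp
  next
    case (Inr h)
    then have h: "h \<in> carrier G2" using Cons.prems by (auto simp: amalg_words_def)
    then have "cls (a # u) = inr (h \<otimes>\<^bsub>G2\<^esub> i2 s) \<otimes>\<^bsub>P\<^esub> cls v"
      using u i v s(3) Inr inl_inr[OF s(1)] by (simp add: cls_Inr inr_mult P.m_assoc)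
    then show ?thesis using absorb_inr[OF _ s(2), of "h \<otimes>\<^bsub>G2\<^esub> i2 s"] h i by simp
  qed
qed

text \<open>The subgroup prefix is absorbed by the first letter, which stays outside the subgroup
  under such a multiplication. Without any letter the element is in the image of the first factor.
  The cases may overlap.\<close>

lemma amalg_cases:
  assumes "a \<in> carrier P"
  obtains (factor) g where "g \<in> carrier G1" "a = inl g"
    | (reduced) v where "reduced v" "v \<noteq> []" "a = cls v"
proof -
  obtain s v where s: "s \<in> carrier S" "reduced v" "a = inl (i1 s) \<otimes>\<^bsub>P\<^esub> cls v"
    using assms normal_form unfolding carrier_P by blast
  have i: "i1 s \<in> carrier G1" "i2 s \<in> carrier G2" using s(1) hom1 hom2 by (auto simp: hom_in_carrier)
  show thesis
  proof (cases v)
    case Nil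
    then have "a = inl (i1 s)" using s i by (simp flip: one_P)
    then show thesis using i factor by blast
  next
    case (Cons b v0)
    have v0: "v0 \<in> W" using s(2) Cons reduced_words[of v] by (auto simp: amalg_words_def)
    show thesis
    proof (cases b)
      case (Inl g)
      then have g: "g \<in> carrier G1 - \<Sigma>1" using s(2) Cons by simp
      then have "i1 s \<otimes>\<^bsub>G1\<^esub> g \<in> carrier G1 - \<Sigma>1"
        using s(1) by (intro coset_notin A.is_group subgroup_image) auto
      then have "reduced (Inl (i1 s \<otimes>\<^bsub>G1\<^esub> g) # v0)" using s(2) Cons Inl by simp
      moreover have "a = cls (Inl (i1 s \<otimes>\<^bsub>G1\<^esub> g) # v0)"
        using s(3) Cons Inl g i v0 by (simp add: cls_Inl inl_mult P.m_assoc)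
      ultimately show thesis using reduced by blast
    next
      case (Inr h)
      then have h: "h \<in> carrier G2 - \<Sigma>2" using s(2) Cons by simp
      then have "i2 s \<otimes>\<^bsub>G2\<^esub> h \<in> carrier G2 - \<Sigma>2"
        using s(1) by (intro coset_notin B.is_group subgroup_image) auto
      then have "reduced (Inr (i2 s \<otimes>\<^bsub>G2\<^esub> h) # v0)" using s(2) Cons Inr by simp
      moreover have "a = cls (Inr (i2 s \<otimes>\<^bsub>G2\<^esub> h) # v0)"
        using s(3) Cons Inr h i v0 inl_inr[OF s(1)] by (simp add: cls_Inr inr_mult P.m_assoc)
      ultimately show thesis using reduced by blast
    qed
  qed
qed

end

section \<open>Generic equivariant bijections\<close>

locale amalg_actions =
  A: sub_action G1 S i1 \<alpha> o1 + B: sub_action G2 S i2 \<beta> o2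
  for G1 :: "('a, 'm) monoid_scheme" and G2 :: "('b, 'n) monoid_scheme"
    and S :: "('c, 'k) monoid_scheme" and i1 :: "'c \<Rightarrow> 'a" and i2 :: "'c \<Rightarrow> 'b"
    and \<alpha> :: "'a \<Rightarrow> 'x \<Rightarrow> 'x" and \<beta> :: "'b \<Rightarrow> 'y \<Rightarrow> 'y"
    and o1 :: "'x \<Rightarrow> nat" and o2 :: "'y \<Rightarrow> nat"
begin

section \<open>Equivariant partial bijections and their extensions\<close>

definition equivariant :: "('x \<times> 'y) set \<Rightarrow> bool" where
  "equivariant p \<longleftrightarrow> (\<forall>x y. \<forall>s\<in>carrier S. (x, y) \<in> p \<longrightarrow> (\<alpha> (i1 s) x, \<beta> (i2 s) y) \<in> p)"

text \<open>The forcing conditions: equivariant partial bijections defined on finitely many orbits of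
  the common subgroup.\<close>

definition cond :: "('x \<times> 'y) set \<Rightarrow> bool" where
  "cond p \<longleftrightarrow> equivariant p \<and> single_valued p \<and> single_valued (p\<inverse>) \<and>
    (\<exists>F. finite F \<and> Domain p \<subseteq> A.sat F) \<and> (\<exists>F. finite F \<and> Range p \<subseteq> B.sat F)"

text \<open>The least equivariant relation that contains the pairs \<open>(X j, Y j)\<close>: new
  pairs are only ever added together with their orbits.\<close>

definition egraph :: "'j set \<Rightarrow> ('j \<Rightarrow> 'x) \<Rightarrow> ('j \<Rightarrow> 'y) \<Rightarrow> ('x \<times> 'y) set" where
  "egraph J X Y = {(\<alpha> (i1 s) (X j), \<beta> (i2 s) (Y j)) | s j. s \<in> carrier S \<and> j \<in> J}"

lemma equivariantD:
  "equivariant p \<Longrightarrow> s \<in> carrier S \<Longrightarrow> (x, y) \<in> p \<Longrightarrow> (\<alpha> (i1 s) x, \<beta> (i2 s) y) \<in> p"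
  by (simp add: equivariant_def)

lemma egraphI: "s \<in> carrier S \<Longrightarrow> j \<in> J \<Longrightarrow> (\<alpha> (i1 s) (X j), \<beta> (i2 s) (Y j)) \<in> egraph J X Y"
  by (auto simp: egraph_def)

lemma egraph_base: "j \<in> J \<Longrightarrow> (X j, Y j) \<in> egraph J X Y"
  using egraphI[of "\<one>\<^bsub>S\<^esub>" j J X Y] by (simp add: A.act_one B.act_one)

lemma Domain_egraph: "Domain (egraph J X Y) = A.sat (X ` J)"
  by (force simp: egraph_def A.sat_def)

lemma Range_egraph: "Range (egraph J X Y) = B.sat (Y ` J)"
  by (force simp: egraph_def B.sat_def)

lemma equivariant_egraph: "equivariant (egraph J X Y)"
  by (force simp: equivariant_def egraph_def simp flip: A.sub_mult B.sub_mult)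

lemma equivariant_Un: "equivariant p \<Longrightarrow> equivariant q \<Longrightarrow> equivariant (p \<union> q)"
  by (simp add: equivariant_def)

lemma equivariant_Domain:
  assumes "equivariant p" "s \<in> carrier S" "\<alpha> (i1 s) x \<in> Domain p"
  shows "x \<in> Domain p"
proof -
  obtain y where "(\<alpha> (i1 s) x, y) \<in> p" using assms(3) by blast
  then have "(\<alpha> (i1 (inv\<^bsub>S\<^esub> s)) (\<alpha> (i1 s) x), \<beta> (i2 (inv\<^bsub>S\<^esub> s)) y) \<in> p"
    using assms(1,2) by (auto intro: equivariantD)
  then show ?thesis using assms(2) by (auto simp: A.sub_inv)
qed

text \<open>The domain of \<open>p\<close> is invariant, so the orbits of the new \<open>X j\<close>
  avoid it; they avoid one another by the last assumption, and freeness makes the subgroup element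
  unique. The claim is one-sided so that it also applies to the converse relation.\<close>

lemma single_valued_extend:
  assumes eq: "equivariant p" and sv: "single_valued p"
    and new: "\<And>j. j \<in> J \<Longrightarrow> X j \<notin> Domain p"
    and trans: "\<And>j j' s. j \<in> J \<Longrightarrow> j' \<in> J \<Longrightarrow> s \<in> carrier S \<Longrightarrow> \<alpha> (i1 s) (X j) = X j' \<Longrightarrow> j = j'"
  shows "single_valued (p \<union> egraph J X Y)"
proof (rule single_valuedI)
  have mixed: False if pu: "(u, v) \<in> p" and su: "(u, v') \<in> egraph J X Y" for u v v'
  proof -
    obtain s j where s: "s \<in> carrier S" "j \<in> J" "u = \<alpha> (i1 s) (X j)" using su by (auto simp: egraph_def)
    then have "X j \<in> Domain p" using equivariant_Domain[OF eq s(1)] pu by blast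
    then show False using new s(2) by blast
  qed
  fix u v v' assume h: "(u, v) \<in> p \<union> egraph J X Y" "(u, v') \<in> p \<union> egraph J X Y"
  show "v = v'"
  proof (cases "(u, v) \<in> p")
    case True
    then have "(u, v') \<in> p" using h(2) mixed by blast
    then show ?thesis using True sv by (auto dest: single_valuedD)
  next
    case False
    then have "(u, v) \<in> egraph J X Y" "(u, v') \<in> egraph J X Y" using h mixed by blast+
    then obtain s j s' j' where s: "s \<in> carrier S" "j \<in> J" "u = \<alpha> (i1 s) (X j)" "v = \<beta> (i2 s) (Y j)"
      "s' \<in> carrier S" "j' \<in> J" "u = \<alpha> (i1 s') (X j')" "v' = \<beta> (i2 s') (Y j')"
      by (auto simp: egraph_def)
    then have "\<alpha> (i1 (inv\<^bsub>S\<^esub> s' \<otimes>\<^bsub>S\<^esub> s)) (X j) = X j'" by (metis A.S.inv_closed A.sub_inv(1) A.sub_mult)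
    then have "j = j'" using s by (intro trans[of j j' "inv\<^bsub>S\<^esub> s' \<otimes>\<^bsub>S\<^esub> s"]) auto
    moreover from this have "s = s'" using s A.sub_cancel by metis
    ultimately show ?thesis using s by simp
  qed
qed

text \<open>The tool of all density arguments, which then only have to find points that are new and
  inequivalent on both sides.\<close>

lemma cond_extend:
  assumes p: "cond p" and J: "finite J"
    and new: "\<And>j. j \<in> J \<Longrightarrow> X j \<notin> Domain p" "\<And>j. j \<in> J \<Longrightarrow> Y j \<notin> Range p"
    and trans: "\<And>j j' s. j \<in> J \<Longrightarrow> j' \<in> J \<Longrightarrow> s \<in> carrier S \<Longrightarrow> \<alpha> (i1 s) (X j) = X j' \<Longrightarrow> j = j'"
      "\<And>j j' s. j \<in> J \<Longrightarrow> j' \<in> J \<Longrightarrow> s \<in> carrier S \<Longrightarrow> \<beta> (i2 s) (Y j) = Y j' \<Longrightarrow> j = j'"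
  shows "cond (p \<union> egraph J X Y)"
proof -
  \<comment> \<open>Converse relations belong to the same setting with the two factors exchanged,
    which turns injectivity into single-valuedness.\<close>
  interpret swap: amalg_actions G2 G1 S i2 i1 \<beta> \<alpha> o2 o1 by unfold_locales
  have eq: "equivariant p" and sv: "single_valued p" "single_valued (p\<inverse>)" using p by (auto simp: cond_def)
  have "swap.equivariant (p\<inverse>)" using eq by (simp add: equivariant_def swap.equivariant_def)
  then have "single_valued (p\<inverse> \<union> swap.egraph J Y X)"
    using sv(2) new(2) trans(2) by (intro swap.single_valued_extend) auto
  moreover have "p\<inverse> \<union> swap.egraph J Y X = (p \<union> egraph J X Y)\<inverse>" by (auto simp: egraph_def swap.egraph_def)
  ultimately have "single_valued ((p \<union> egraph J X Y)\<inverse>)" by simp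
  moreover have "single_valued (p \<union> egraph J X Y)"
    using eq sv(1) new(1) trans(1) by (rule single_valued_extend)
  moreover have "\<exists>F. finite F \<and> Domain (p \<union> egraph J X Y) \<subseteq> A.sat F"
  proof -
    obtain F where "finite F" "Domain p \<subseteq> A.sat F" using p by (auto simp: cond_def)
    then show ?thesis using J
      by (intro exI[of _ "F \<union> X ` J"]) (auto simp: A.sat_Un Domain_Un_eq Domain_egraph)
  qed
  moreover have "\<exists>F. finite F \<and> Range (p \<union> egraph J X Y) \<subseteq> B.sat F"
  proof -
    obtain F where "finite F" "Range p \<subseteq> B.sat F" using p by (auto simp: cond_def)
    then show ?thesis using J
      by (intro exI[of _ "F \<union> Y ` J"]) (auto simp: B.sat_Un Range_Un_eq Range_egraph)
  qed
  ultimately show ?thesis unfolding cond_def using eq equivariant_egraph equivariant_Un by blast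
qed

section \<open>Dense requirements on partial bijections\<close>

lemma cond_empty: "cond {}"
  by (auto simp: cond_def equivariant_def intro!: exI[of _ "{}"])

lemma cond_finite_orbits:
  assumes "cond p"
  obtains F1 F2 where "finite F1" "Domain p \<subseteq> A.sat F1" "finite F2" "Range p \<subseteq> B.sat F2"
  using assms by (auto simp: cond_def)

lemma fresh_notin_Domain: "Domain p \<subseteq> A.sat F \<Longrightarrow> o1 x \<notin> o1 ` F \<Longrightarrow> x \<notin> Domain p"
  using A.orb_sat by blast

lemma fresh_notin_Range: "Range p \<subseteq> B.sat F \<Longrightarrow> o2 y \<notin> o2 ` F \<Longrightarrow> y \<notin> Range p"
  using B.orb_sat by blast

lemma dense_Domain:
  assumes "cond p"
  shows "\<exists>p'. cond p' \<and> p \<subseteq> p' \<and> x \<in> Domain p'"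
proof (cases "x \<in> Domain p")
  case False
  obtain F1 F2 where F: "finite F1" "Domain p \<subseteq> A.sat F1" "finite F2" "Range p \<subseteq> B.sat F2"
    using cond_finite_orbits[OF assms] .
  obtain z :: "nat \<Rightarrow> 'y" where z: "\<And>k. o2 (z k) \<notin> o2 ` F2" using B.fresh_points[of "o2 ` F2"] F(3) by blast
  let ?q = "egraph {()} (\<lambda>_. x) (\<lambda>_. z 0)"
  have "cond (p \<union> ?q)"
    using False fresh_notin_Range[OF F(4) z] by (intro cond_extend[OF assms]) auto
  moreover have "(x, z 0) \<in> ?q" by (rule egraph_base) simp
  ultimately show ?thesis by blast
qed (use assms in blast)

lemma dense_Range:
  assumes "cond p"
  shows "\<exists>p'. cond p' \<and> p \<subseteq> p' \<and> y \<in> Range p'"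
proof (cases "y \<in> Range p")
  case False
  obtain F1 F2 where F: "finite F1" "Domain p \<subseteq> A.sat F1" "finite F2" "Range p \<subseteq> B.sat F2"
    using cond_finite_orbits[OF assms] .
  obtain z :: "nat \<Rightarrow> 'x" where z: "\<And>k. o1 (z k) \<notin> o1 ` F1" using A.fresh_points[of "o1 ` F1"] F(1) by blast
  let ?q = "egraph {()} (\<lambda>_. z 0) (\<lambda>_. y)"
  have "cond (p \<union> ?q)"
    using False fresh_notin_Domain[OF F(2) z] by (intro cond_extend[OF assms]) auto
  moreover have "(z 0, y) \<in> ?q" by (rule egraph_base) simp
  ultimately show ?thesis by blast
qed (use assms in blast)

text \<open>If \<open>p\<close> is part of the graph of \<open>w\<close>, then \<open>g\<close>,
  followed by the conjugate of \<open>h\<close> under \<open>w\<close> and by the inverse of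
  \<open>g'\<close>, maps each \<open>x\<close> to its partner \<open>x'\<close>. The middle point
  \<open>y\<close> is the image of \<open>\<alpha> g x\<close>.\<close>

definition sends :: "('x \<times> 'x) list \<Rightarrow> ('x \<times> 'y) set \<Rightarrow> bool" where
  "sends l p \<longleftrightarrow> (\<exists>g\<in>carrier G1. \<exists>g'\<in>carrier G1. \<exists>h\<in>carrier G2.
    \<forall>(x, x')\<in>set l. \<exists>y. (\<alpha> g x, y) \<in> p \<and> (\<alpha> g' x', \<beta> h y) \<in> p)"

text \<open>Sources and targets are moved by \<open>g\<close> and \<open>g'\<close> to places where
  \<open>p\<close> is undefined. There \<open>\<alpha> g x\<close> is matched with a fresh
  \<open>z k\<close> and \<open>\<alpha> g' x'\<close> with \<open>\<beta> h (z k)\<close>, so that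
  \<open>h\<close> carries one to the other.\<close>

lemma dense_sends:
  assumes p: "cond p"
    and hcf: "highly_core_free G1 (i1 ` carrier S)" "highly_core_free G2 (i2 ` carrier S)"
    and inf: "infinite (carrier G1)" "infinite (carrier G2)"
    and dist: "distinct (map fst l)" "distinct (map snd l)"
  shows "\<exists>p'. cond p' \<and> p \<subseteq> p' \<and> sends l p'"
proof -
  obtain F1 F2 where F: "finite F1" "Domain p \<subseteq> A.sat F1" "finite F2" "Range p \<subseteq> B.sat F2"
    using cond_finite_orbits[OF p] .
  let ?x = "\<lambda>k. fst (l ! k)" and ?x' = "\<lambda>k. snd (l ! k)" and ?n = "length l"
  have fin: "finite (fst ` set l)" "finite (snd ` set l)" by auto
  obtain g where g: "g \<in> carrier G1" "\<forall>x\<in>fst ` set l. \<alpha> g x \<notin> A.sat F1"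
    "\<forall>x\<in>fst ` set l. \<forall>x'\<in>fst ` set l. \<forall>s\<in>carrier S. \<alpha> (i1 s) (\<alpha> g x) = \<alpha> g x' \<longrightarrow> x = x'"
    using A.move_apart[OF hcf(1) inf(1) fin(1) F(1)] .
  \<comment> \<open>The targets must also avoid the new positions of the sources, which are
    therefore added to the set to be avoided.\<close>
  have fin3: "finite (F1 \<union> \<alpha> g ` fst ` set l)" using F(1) by simp
  obtain g' where g': "g' \<in> carrier G1" "\<forall>x\<in>snd ` set l. \<alpha> g' x \<notin> A.sat (F1 \<union> \<alpha> g ` fst ` set l)"
    "\<forall>x\<in>snd ` set l. \<forall>x'\<in>snd ` set l. \<forall>s\<in>carrier S. \<alpha> (i1 s) (\<alpha> g' x) = \<alpha> g' x' \<longrightarrow> x = x'"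
    using A.move_apart[OF hcf(1) inf(1) fin(2) fin3] .
  \<comment> \<open>An \<open>h\<close> outside the subgroup keeps \<open>z k\<close> and
    \<open>\<beta> h (z k)\<close> in different orbits of the subgroup, although they share an orbit
    of the second factor.\<close>
  obtain h where h: "h \<in> carrier G2" "h \<notin> i2 ` carrier S" using B.ex_not_in_sub[OF hcf(2) inf(2)] by blast
  obtain z :: "nat \<Rightarrow> 'y" where z: "\<And>k. o2 (z k) \<notin> o2 ` F2" "inj (o2 \<circ> z)"
    using B.fresh_points[of "o2 ` F2"] F(3) by blast
  let ?J = "(UNIV :: bool set) \<times> {..<?n}"
  let ?X = "\<lambda>(b, k). if b then \<alpha> g (?x k) else \<alpha> g' (?x' k)"
  let ?Y = "\<lambda>(b, k). if b then z k else \<beta> h (z k)"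
  have mem: "?x k \<in> fst ` set l" "?x' k \<in> snd ` set l" if "k < ?n" for k using that by auto
  have inj: "?x k = ?x j \<longleftrightarrow> k = j" "?x' k = ?x' j \<longleftrightarrow> k = j" if "k < ?n" "j < ?n" for k j
    using dist that by (metis length_map nth_eq_iff_index_eq nth_map)+
  have zinj: "o2 (z k) = o2 (z j) \<longleftrightarrow> k = j" for k j using z(2) by (auto simp: inj_def)
  have "cond (p \<union> egraph ?J ?X ?Y)"
  proof (rule cond_extend[OF p])
    show "?X j \<notin> Domain p" if "j \<in> ?J" for j
    proof -
      have "?X j \<notin> A.sat F1" using that g(2) g'(2) mem by (auto simp: A.sat_Un split: prod.splits)
      then show ?thesis using F(2) by blast
    qed
    show "?Y j \<notin> Range p" if "j \<in> ?J" for j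
    proof -
      have "o2 (?Y j) \<notin> o2 ` F2" using z(1) h(1) by (auto split: prod.splits)
      then show ?thesis by (rule fresh_notin_Range[OF F(4)])
    qed
    have no: "\<alpha> (i1 s) (\<alpha> g (?x k)) \<noteq> \<alpha> g' (?x' j)" "\<alpha> (i1 s) (\<alpha> g' (?x' j)) \<noteq> \<alpha> g (?x k)"
      if "s \<in> carrier S" "k < ?n" "j < ?n" for s k j
    proof -
      have new: "\<alpha> g' (?x' j) \<notin> A.sat (\<alpha> g ` fst ` set l)" using bspec[OF g'(2) mem(2)] that(3) by (simp add: A.sat_Un)
      have base: "\<alpha> g (?x k) \<in> \<alpha> g ` fst ` set l" using mem(1)[OF that(2)] by blast
      show "\<alpha> (i1 s) (\<alpha> g (?x k)) \<noteq> \<alpha> g' (?x' j)" using new A.satI[OF that(1) base] by metis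
      show "\<alpha> (i1 s) (\<alpha> g' (?x' j)) \<noteq> \<alpha> g (?x k)"
        using new A.sat_invariant[OF that(1)] base A.sat_superset by (metis subsetD)
    qed
    show "j = j'" if "j \<in> ?J" "j' \<in> ?J" "s \<in> carrier S" "\<alpha> (i1 s) (?X j) = ?X j'" for j j' s
    proof -
      obtain b k b' k' where j: "j = (b, k)" "j' = (b', k')" "k < ?n" "k' < ?n" using \<open>j \<in> ?J\<close> \<open>j' \<in> ?J\<close> by auto
      show ?thesis
      proof (cases b; cases b')
        assume b: b b'
        then have "?x k = ?x k'" using that(4) j by (intro g(3)[rule_format, OF mem(1) mem(1) that(3)]) auto
        then show ?thesis using inj(1) j b by simp
      next
        assume b: "\<not> b" "\<not> b'"
        then have "?x' k = ?x' k'" using that(4) j by (intro g'(3)[rule_format, OF mem(2) mem(2) that(3)]) auto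
        then show ?thesis using inj(2) j b by simp
      qed (use no[OF that(3) j(3,4)] no[OF that(3) j(4,3)] that(4) j(1,2) in auto)
    qed
    have ne: "\<beta> (i2 s) (z k) \<noteq> \<beta> h (z k)" if "s \<in> carrier S" for s k
      using B.act_cancel[of "i2 s" h "z k"] h that by (metis B.i_closed imageI)
    have ne': "\<beta> (i2 s) (\<beta> h (z k)) \<noteq> z k" if "s \<in> carrier S" for s k
      using ne[of "inv\<^bsub>S\<^esub> s"] B.sub_inv(1)[OF that, of "\<beta> h (z k)"] that by (metis A.S.inv_closed)
    show "j = j'" if "j \<in> ?J" "j' \<in> ?J" "s \<in> carrier S" "\<beta> (i2 s) (?Y j) = ?Y j'" for j j' s
    proof -
      obtain b k b' k' where j: "j = (b, k)" "j' = (b', k')" using \<open>j \<in> ?J\<close> \<open>j' \<in> ?J\<close> by auto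
      have "o2 (?Y j) = o2 (z k)" "o2 (?Y j') = o2 (z k')" using h(1) j by auto
      moreover have "o2 (\<beta> (i2 s) (?Y j)) = o2 (?Y j)" using that(3) by simp
      ultimately have "k = k'" using zinj[of k k'] unfolding that(4) by argo
      then show ?thesis using ne[OF that(3)] ne'[OF that(3)] that(4) j by (cases b; cases b') auto
    qed
  qed simp
  moreover have "sends l (p \<union> egraph ?J ?X ?Y)"
    unfolding sends_def
  proof (rule bexI[OF _ g(1)], rule bexI[OF _ g'(1)], rule bexI[OF _ h(1)], clarify)
    fix x x' assume "(x, x') \<in> set l"
    then obtain k where k: "k < ?n" "l ! k = (x, x')" by (auto simp: in_set_conv_nth)
    have "(?X (b, k), ?Y (b, k)) \<in> egraph ?J ?X ?Y" for b using k(1) by (intro egraph_base) auto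
    from this[of True] this[of False] show "\<exists>y. (\<alpha> g x, y) \<in> p \<union> egraph ?J ?X ?Y \<and> (\<alpha> g' x', \<beta> h y) \<in> p \<union> egraph ?J ?X ?Y"
      using k(2) by auto
  qed
  ultimately show ?thesis by blast
qed

sublocale amalg_data G1 G2 S i1 i2
  by unfold_locales (rule A.mon B.mon)+

text \<open>The partial action of a word on the first set, as far as \<open>p\<close> determines it,
  with letters acting from right to left. A letter of the second factor acts by its conjugate under
  the bijection, which two pairs of \<open>p\<close> express.\<close>

fun trace :: "('x \<times> 'y) set \<Rightarrow> ('a + 'b) list \<Rightarrow> ('x \<times> 'x) set" where
  "trace p [] = Id"
| "trace p (Inl g # u) = {(x, \<alpha> g x') | x x'. (x, x') \<in> trace p u}"
| "trace p (Inr h # u) = {(x, x''). \<exists>x' y. (x, x') \<in> trace p u \<and> (x', y) \<in> p \<and> (x'', \<beta> h y) \<in> p}"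

lemma trace_mono: "p \<subseteq> p' \<Longrightarrow> trace p u \<subseteq> trace p' u"
  by (induction p u rule: trace.induct) (simp, (simp, blast)+)

text \<open>The trajectory of a point is prolonged letter by letter.  It keeps ending outside the domain
  of the condition, either immediately or after any further letter from the first factor.\<close>

lemma dense_moved_aux:
  assumes "cond p" and "reduced u"
  shows "\<exists>p' x x'. cond p' \<and> p \<subseteq> p' \<and> (x, x') \<in> trace p' u \<and> (u \<noteq> [] \<longrightarrow> x' \<noteq> x) \<and>
    (u = [] \<or> isl (hd u) \<longrightarrow> x' \<notin> Domain p') \<and>
    (u = [] \<or> \<not> isl (hd u) \<longrightarrow> (\<forall>g\<in>carrier G1 - \<Sigma>1. \<alpha> g x' \<notin> Domain p' \<and> \<alpha> g x' \<noteq> x))"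
  using assms(2)
\<comment> \<open>The last two clauses of the claim prepare for a next letter from the second and
  the first factor respectively. Both hold for the empty word, before which either kind may be
  put.\<close>
proof (induction u rule: reduced.induct)
  case 1
  obtain F1 F2 where F: "finite F1" "Domain p \<subseteq> A.sat F1" "finite F2" "Range p \<subseteq> B.sat F2"
    using cond_finite_orbits[OF assms(1)] .
  obtain z :: "nat \<Rightarrow> 'x" where z: "\<And>k. o1 (z k) \<notin> o1 ` F1" using A.fresh_points[of "o1 ` F1"] F(1) by blast
  have "z 0 \<notin> Domain p" by (rule fresh_notin_Domain[OF F(2) z])
  moreover have "\<alpha> g (z 0) \<notin> Domain p \<and> \<alpha> g (z 0) \<noteq> z 0" if g: "g \<in> carrier G1 - \<Sigma>1" for g
  proof
    show "\<alpha> g (z 0) \<notin> Domain p" using g z by (intro fresh_notin_Domain[OF F(2)]) simp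
    show "\<alpha> g (z 0) \<noteq> z 0" using g A.act_free A.one_in_image by blast
  qed
  ultimately show ?case using assms(1) by (intro exI[of _ p] exI[of _ "z 0"]) simp
next
  case (2 g u)
  then obtain p' x x' where p': "cond p'" "p \<subseteq> p'" "(x, x') \<in> trace p' u"
    and x': "\<forall>g\<in>carrier G1 - \<Sigma>1. \<alpha> g x' \<notin> Domain p' \<and> \<alpha> g x' \<noteq> x" by auto
  have "\<alpha> g x' \<notin> Domain p' \<and> \<alpha> g x' \<noteq> x" using 2(2) by (intro bspec[OF x']) simp
  moreover have "(x, \<alpha> g x') \<in> trace p' (Inl g # u)" using p'(3) by auto
  ultimately show ?case using p'(1,2)
    by (intro exI[of _ p'] exI[of _ x] exI[of _ "\<alpha> g x'"]) simp
next
  case (3 h u)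
  then obtain p' x x' where p': "cond p'" "p \<subseteq> p'" "(x, x') \<in> trace p' u" "x' \<notin> Domain p'" by auto
  have h: "h \<in> carrier G2" "h \<notin> \<Sigma>2" using 3(2) by auto
  obtain F1 F2 where F: "finite F1" "Domain p' \<subseteq> A.sat F1" "finite F2" "Range p' \<subseteq> B.sat F2"
    using cond_finite_orbits[OF p'(1)] .
  obtain z :: "nat \<Rightarrow> 'x" where z: "\<And>k. o1 (z k) \<notin> o1 ` (F1 \<union> {x, x'})"
    using A.fresh_points[of "o1 ` (F1 \<union> {x, x'})"] F(1) by blast
  obtain t :: "nat \<Rightarrow> 'y" where t: "\<And>k. o2 (t k) \<notin> o2 ` F2" using B.fresh_points[of "o2 ` F2"] F(3) by blast
  let ?x = "z 0" and ?y = "t 0"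
  have orb: "o1 ?x \<notin> o1 ` F1" "o1 ?x \<noteq> o1 x" "o1 ?x \<noteq> o1 x'" using z[of 0] by auto
  \<comment> \<open>The end point \<open>x'\<close> is matched with a fresh \<open>?y\<close>, and a
    fresh \<open>?x\<close> with \<open>\<beta> h ?y\<close>. Thus \<open>h\<close> leads from
    \<open>x'\<close> to \<open>?x\<close>, whose orbit differs from those of \<open>x\<close> and
    \<open>x'\<close>.\<close>
  let ?X = "\<lambda>b. if b then x' else ?x" and ?Y = "\<lambda>b. if b then ?y else \<beta> h ?y"
  let ?q = "egraph UNIV ?X ?Y"
  have ne: "\<beta> (i2 s) ?y \<noteq> \<beta> h ?y" if "s \<in> carrier S" for s
    using B.act_cancel[of "i2 s" h ?y] h that by (metis B.i_closed imageI)
  have ne': "\<beta> (i2 s) (\<beta> h ?y) \<noteq> ?y" if "s \<in> carrier S" for s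
    using ne[of "inv\<^bsub>S\<^esub> s"] B.sub_inv(1)[OF that, of "\<beta> h ?y"] that by (metis A.S.inv_closed)
  have neX: "\<alpha> (i1 s) x' \<noteq> ?x" "\<alpha> (i1 s) ?x \<noteq> x'" if "s \<in> carrier S" for s
    using orb(3) A.orb_act[OF A.i_closed[OF that]] by metis+
  have cond: "cond (p' \<union> ?q)"
  proof (rule cond_extend[OF p'(1)])
    show "?X b \<notin> Domain p'" for b using p'(4) fresh_notin_Domain[OF F(2) orb(1)] by simp
    have "?y \<notin> Range p'" by (rule fresh_notin_Range[OF F(4) t])
    moreover have "\<beta> h ?y \<notin> Range p'" using t h(1) by (intro fresh_notin_Range[OF F(4)]) simp
    ultimately show "?Y b \<notin> Range p'" for b by simp
    show "b = b'" if "s \<in> carrier S" "\<alpha> (i1 s) (?X b) = ?X b'" for b b' s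
      using that(2) neX[OF that(1)] by (cases b; cases b') auto
    show "b = b'" if "s \<in> carrier S" "\<beta> (i2 s) (?Y b) = ?Y b'" for b b' s
      using that(2) ne[OF that(1)] ne'[OF that(1)] by (cases b; cases b') auto
  qed simp
  have q: "(x', ?y) \<in> ?q" "(?x, \<beta> h ?y) \<in> ?q"
    using egraph_base[of True UNIV ?X ?Y] egraph_base[of False UNIV ?X ?Y] by simp_all
  have "(x, x') \<in> trace (p' \<union> ?q) u" using p'(3) trace_mono[of p' "p' \<union> ?q"] by blast
  then have "(x, ?x) \<in> trace (p' \<union> ?q) (Inr h # u)" using q by auto
  moreover have "?x \<noteq> x" using orb(2) by auto
  moreover have "\<alpha> g ?x \<notin> Domain (p' \<union> ?q) \<and> \<alpha> g ?x \<noteq> x" if g: "g \<in> carrier G1 - \<Sigma>1" for g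
  proof
    have o: "o1 (\<alpha> g ?x) = o1 ?x" using g by simp
    then show "\<alpha> g ?x \<noteq> x" using orb(2) by metis
    have "\<alpha> g ?x \<notin> Domain p'" using o orb(1) by (intro fresh_notin_Domain[OF F(2)]) simp
    \<comment> \<open>Within the orbit of \<open>?x\<close> under the first factor, the new
      condition is defined only on the subgroup orbit of \<open>?x\<close>, and \<open>g\<close>
      leaves this as it is outside the subgroup.\<close>
    moreover have "\<alpha> g ?x \<noteq> \<alpha> (i1 s) ?x" if "s \<in> carrier S" for s
      using A.act_cancel[of g "i1 s" ?x] g that by auto
    moreover have "\<alpha> g ?x \<noteq> \<alpha> (i1 s) x'" if "s \<in> carrier S" for s
      using o orb(3) A.orb_act[OF A.i_closed[OF that]] by metis
    ultimately show "\<alpha> g ?x \<notin> Domain (p' \<union> ?q)"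
      by (auto simp: Domain_Un_eq Domain_egraph A.sat_def split: if_splits)
  qed
  ultimately show ?case using cond p'(2)
    by (intro exI[of _ "p' \<union> ?q"] exI[of _ x] exI[of _ ?x]) auto
qed

definition moved :: "('a + 'b) list \<Rightarrow> ('x \<times> 'y) set \<Rightarrow> bool" where
  "moved u p \<longleftrightarrow> (\<exists>x x'. (x, x') \<in> trace p u \<and> x' \<noteq> x)"

lemma dense_moved:
  assumes "cond p" "reduced u" "u \<noteq> []"
  shows "\<exists>p'. cond p' \<and> p \<subseteq> p' \<and> moved u p'"
  using dense_moved_aux[OF assms(1,2)] assms(3) unfolding moved_def by blast

text \<open>One finite set that is almost invariant for both actions: the second estimate concerns
  the image of \<open>C\<close> under \<open>p\<close>, and the bijection pulls it back to
  \<open>C\<close>.\<close>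

definition folner_pair :: "'a set \<Rightarrow> 'b set \<Rightarrow> real \<Rightarrow> ('x \<times> 'y) set \<Rightarrow> bool" where
  "folner_pair K1 K2 e p \<longleftrightarrow> (\<exists>C. finite C \<and> C \<noteq> {} \<and> C \<subseteq> Domain p \<and>
    (\<forall>k\<in>K1. real (card (\<alpha> k ` C - C)) \<le> e * card C) \<and>
    (\<forall>k\<in>K2. real (card (\<beta> k ` (p `` C) - p `` C)) \<le> e * card C))"

text \<open>Folner sets of equal size for the two factors are unions of equally many orbits of the
  finite subgroup. A bijection between transversals extends equivariantly and maps one set onto the
  other.\<close>

lemma dense_folner_pair:
  assumes p: "cond p" and am: "amenable_group G1" "amenable_group G2"
    and inf1: "countable (carrier G1)" "infinite (carrier G1)"
    and inf2: "countable (carrier G2)" "infinite (carrier G2)"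
    and S: "finite (carrier S)" and K1: "finite K1" "K1 \<subseteq> carrier G1" and K2: "finite K2" "K2 \<subseteq> carrier G2"
    and e: "0 < e"
  shows "\<exists>p'. cond p' \<and> p \<subseteq> p' \<and> folner_pair K1 K2 e p'"
proof -
  obtain F1 F2 where F: "finite F1" "Domain p \<subseteq> A.sat F1" "finite F2" "Range p \<subseteq> B.sat F2"
    using cond_finite_orbits[OF p] .
  obtain c where c: "0 < c" "\<forall>q N. finite N \<longrightarrow> (\<exists>C. finite C \<and> card C = c * q \<and> A.sat C = C \<and>
      o1 ` C \<inter> N = {} \<and> (\<forall>k\<in>K1. real (card (\<alpha> k ` C - C)) \<le> e * card C))"
    using A.folner_sets[OF am(1) inf1 S K1 e] by (elim exE conjE) (rule that)
  obtain d where d: "0 < d" "\<forall>q N. finite N \<longrightarrow> (\<exists>D. finite D \<and> card D = d * q \<and> B.sat D = D \<and>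
      o2 ` D \<inter> N = {} \<and> (\<forall>k\<in>K2. real (card (\<beta> k ` D - D)) \<le> e * card D))"
    using B.folner_sets[OF am(2) inf2 S K2 e] by (elim exE conjE) (rule that)
  have "finite (o1 ` F1)" "finite (o2 ` F2)" using F by auto
  \<comment> \<open>The multiplicities are taken crosswise, \<open>d\<close> copies on one side and
    \<open>c\<close> on the other, which makes both sizes equal to \<open>c * d\<close>.\<close>
  then obtain C D where C: "finite C" "card C = c * d" "A.sat C = C" "o1 ` C \<inter> o1 ` F1 = {}"
      "\<forall>k\<in>K1. real (card (\<alpha> k ` C - C)) \<le> e * card C"
    and D: "finite D" "card D = d * c" "B.sat D = D" "o2 ` D \<inter> o2 ` F2 = {}"
      "\<forall>k\<in>K2. real (card (\<beta> k ` D - D)) \<le> e * card D"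
    using c(2)[rule_format, of "o1 ` F1" d] d(2)[rule_format, of "o2 ` F2" c] by metis
  obtain T where T: "T \<subseteq> C" "A.sat T = C" "\<forall>x\<in>T. \<forall>x'\<in>T. \<forall>s\<in>carrier S. \<alpha> (i1 s) x = x' \<longrightarrow> x = x'"
    using A.sat_transversal[OF C(3)] by blast
  obtain U where U: "U \<subseteq> D" "B.sat U = D" "\<forall>x\<in>U. \<forall>x'\<in>U. \<forall>s\<in>carrier S. \<beta> (i2 s) x = x' \<longrightarrow> x = x'"
    using B.sat_transversal[OF D(3)] by blast
  have fin: "finite T" "finite U" using T(1) U(1) C(1) D(1) finite_subset by auto
  have "0 < card (carrier S)" using S A.S.one_closed by (auto simp: card_gt_0_iff)
  moreover have "card (carrier S) * card T = card (carrier S) * card U"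
    using A.card_sat_transversal[OF T(3)] B.card_sat_transversal[OF U(3)] T(2) U(2) C(2) D(2)
    by (simp add: mult.commute)
  ultimately have "card T = card U" by simp
  then obtain b where b: "bij_betw b T U" using fin finite_same_card_bij by blast
  then have bU: "b x \<in> U" if "x \<in> T" for x using that by (auto simp: bij_betw_def)
  have b_inj: "b x = b x' \<longleftrightarrow> x = x'" if "x \<in> T" "x' \<in> T" for x x'
    using b that by (auto simp: bij_betw_def inj_on_def)
  let ?q = "egraph T (\<lambda>x. x) b"
  have CF: "x \<notin> Domain p" if "x \<in> C" for x using C(4) that by (intro fresh_notin_Domain[OF F(2)]) blast
  have DF: "y \<notin> Range p" if "y \<in> D" for y using D(4) that by (intro fresh_notin_Range[OF F(4)]) blast
  have "cond (p \<union> ?q)"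
  proof (rule cond_extend[OF p fin(1)])
    show "x \<notin> Domain p" if "x \<in> T" for x using CF that T(1) by blast
    show "b x \<notin> Range p" if "x \<in> T" for x using DF bU[OF that] U(1) by blast
    show "x = x'" if "x \<in> T" "x' \<in> T" "s \<in> carrier S" "\<alpha> (i1 s) x = x'" for x x' s using that T(3) by blast
    show "x = x'" if "x \<in> T" "x' \<in> T" "s \<in> carrier S" "\<beta> (i2 s) (b x) = b x'" for x x' s
      using that U(3)[rule_format, OF bU[OF that(1)] bU[OF that(2)] that(3,4)] b_inj by blast
  qed
  moreover have "folner_pair K1 K2 e (p \<union> ?q)"
  proof -
    have dom: "Domain ?q = C" using T(2) by (simp add: Domain_egraph)
    have "Range ?q = D" using U(2) b by (simp add: Range_egraph bij_betw_def)
    then have img: "(p \<union> ?q) `` C = D" using dom CF by blast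
    have "C \<noteq> {}" using C(1,2) c(1) d(1) by auto
    moreover have "card C = card D" using C(2) D(2) by simp
    ultimately show ?thesis unfolding folner_pair_def
      using C(1,5) D(5) dom by (intro exI[of _ C]) (auto simp: img)
  qed
  ultimately show ?thesis by blast
qed

section \<open>The limit of a chain of conditions\<close>

lemma generic_bijection:
  assumes ctbl: "countable (UNIV :: 'x set)" "countable (UNIV :: 'y set)" "countable \<D>"
    and dense: "\<And>Q p. Q \<in> \<D> \<Longrightarrow> cond p \<Longrightarrow> \<exists>p'. cond p' \<and> p \<subseteq> p' \<and> Q p'"
  shows "\<exists>w. bij w \<and> (\<forall>s\<in>carrier S. \<forall>x. w (\<alpha> (i1 s) x) = \<beta> (i2 s) (w x)) \<and>
    (\<forall>Q\<in>\<D>. \<exists>p. Q p \<and> (\<forall>(x, y)\<in>p. w x = y))"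
proof -
  \<comment> \<open>Having a given point in the domain or in the range is itself a dense
    requirement; adding these makes the union of the chain total and onto.\<close>
  let ?E = "\<D> \<union> range (\<lambda>x p. x \<in> Domain p) \<union> range (\<lambda>y p. y \<in> Range p)"
  have "countable ?E" "?E \<noteq> {}" using ctbl by auto
  then have Q: "range (from_nat_into ?E) = ?E" by (intro range_from_nat_into)
  define Q where "Q = from_nat_into ?E"
  note Q = Q[folded Q_def]
  have Q_dense: "\<exists>p'. cond p' \<and> p \<subseteq> p' \<and> Q n p'" if "cond p" for n p
  proof -
    have "Q n \<in> ?E" using Q by blast
    then consider "Q n \<in> \<D>" | x where "Q n = (\<lambda>p. x \<in> Domain p)" | y where "Q n = (\<lambda>p. y \<in> Range p)" by blast
    then show ?thesis
    proof cases
      case 1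
      then show ?thesis using dense that by blast
    qed (simp_all only: dense_Domain[OF that] dense_Range[OF that])
  qed
  have "\<exists>P. \<forall>n. cond (P n) \<and> (P n \<subseteq> P (Suc n) \<and> Q n (P (Suc n)))"
    by (rule dependent_nat_choice) (use cond_empty Q_dense in blast)+
  then obtain P where P: "\<And>n. cond (P n)" "\<And>n. P n \<subseteq> P (Suc n)" "\<And>n. Q n (P (Suc n))" by blast
  define R where "R = (\<Union>n. P n)"
  have mono: "P m \<subseteq> P n" if "m \<le> n" for m n using lift_Suc_mono_le[of P, OF P(2) that] .
  have common: "\<exists>n. r \<in> P n \<and> r' \<in> P n" if "r \<in> R" "r' \<in> R" for r r'
  proof -
    obtain m n where "r \<in> P m" "r' \<in> P n" using \<open>r \<in> R\<close> \<open>r' \<in> R\<close> by (auto simp: R_def)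
    then have "r \<in> P (max m n)" "r' \<in> P (max m n)" using mono[of m "max m n"] mono[of n "max m n"] by auto
    then show ?thesis by blast
  qed
  have met: "\<exists>n. q (P n)" if "q \<in> ?E" for q
  proof -
    have "q \<in> range Q" using that by (simp only: Q)
    then obtain n where "q = Q n" by blast
    then show ?thesis using P(3) by blast
  qed
  have total: "\<exists>y. (x, y) \<in> R" for x
  proof -
    obtain n where "x \<in> Domain (P n)" using met[of "\<lambda>p. x \<in> Domain p"] by blast
    then show ?thesis by (auto simp: R_def)
  qed
  have onto: "\<exists>x. (x, y) \<in> R" for y
  proof -
    obtain n where "y \<in> Range (P n)" using met[of "\<lambda>p. y \<in> Range p"] by blast
    then show ?thesis by (auto simp: R_def)
  qed
  have fun_R: "y = y'" if xy: "(x, y) \<in> R" "(x, y') \<in> R" for x y y'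
  proof -
    obtain n where "(x, y) \<in> P n" "(x, y') \<in> P n" using common[OF xy] by blast
    then show ?thesis using P(1)[of n] unfolding cond_def by (meson single_valuedD)
  qed
  have inj_R: "x = x'" if xy: "(x, y) \<in> R" "(x', y) \<in> R" for x x' y
  proof -
    obtain n where "(y, x) \<in> (P n)\<inverse>" "(y, x') \<in> (P n)\<inverse>" using common[OF xy] by blast
    then show ?thesis using P(1)[of n] unfolding cond_def by (meson single_valuedD)
  qed
  obtain w where w: "\<And>x. (x, w x) \<in> R" using total by metis
  have wR: "w x = y" if "(x, y) \<in> R" for x y using fun_R[OF w that] .
  show ?thesis
  proof (intro exI[of _ w] conjI ballI allI)
    show "bij w"
    proof (rule bijI)
      show "inj w" using inj_R w by (metis injI)
      show "surj w" using onto wR by (metis surjI)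
    qed
    fix s x assume s: "s \<in> carrier S"
    obtain n where "(x, w x) \<in> P n" using w by (auto simp: R_def)
    then have "(\<alpha> (i1 s) x, \<beta> (i2 s) (w x)) \<in> P n" using P(1)[of n] s by (auto simp: cond_def intro: equivariantD)
    then show "w (\<alpha> (i1 s) x) = \<beta> (i2 s) (w x)" by (intro wR) (auto simp: R_def)
  next
    fix q assume "q \<in> \<D>"
    then obtain n where "q (P n)" using met[of q] by blast
    moreover have "\<forall>(x, y)\<in>P n. w x = y" using wR by (auto simp: R_def)
    ultimately show "\<exists>p. q p \<and> (\<forall>(x, y)\<in>p. w x = y)" by blast
  qed
qed

end

section \<open>Actions of the amalgam\<close>

lemma BijGroup_UNIV:
  "carrier (BijGroup UNIV) = {f. bij f}" "\<one>\<^bsub>BijGroup UNIV\<^esub> = id"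
  "bij f \<Longrightarrow> bij g \<Longrightarrow> f \<otimes>\<^bsub>BijGroup UNIV\<^esub> g = f \<circ> g"
  by (auto simp: BijGroup_def Bij_def compose_def extensional_def fun_eq_iff)

text \<open>The model is left multiplication on the first coordinate of
  \<open>carrier G \<times> UNIV\<close>, with the second coordinate as the number of the orbit. An
  enumeration \<open>e\<close> carries it over to the natural numbers.\<close>

lemma (in group) regular_sub_action:
  assumes "infinite (carrier G)" "countable (carrier G)" "group S" "i \<in> mon S G"
  shows "\<exists>(\<alpha> :: 'a \<Rightarrow> nat \<Rightarrow> nat) orb. sub_action G S i \<alpha> orb"
proof -
  let ?I = "carrier G \<times> (UNIV :: nat set)"
  have "countable ?I" "infinite ?I"
    using assms(1,2) by (auto simp: finite_cartesian_product_iff)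
  then have e: "bij_betw (from_nat_into ?I) UNIV ?I" by (rule bij_betw_from_nat_into)
  define e where "e = from_nat_into ?I"
  define d where "d = inv_into UNIV e"
  have mem: "fst (e x) \<in> carrier G" for x
    using e unfolding e_def[symmetric] bij_betw_def by (metis mem_Times_iff rangeI)
  have de: "d (e x) = x" for x using e unfolding e_def[symmetric] d_def by (simp add: bij_betw_def)
  have ed: "e (d (g, n)) = (g, n)" if "g \<in> carrier G" for g n
    using e that unfolding e_def[symmetric] d_def bij_betw_def by (intro f_inv_into_f) auto
  define \<alpha> where "\<alpha> = (\<lambda>g x. d (g \<otimes> fst (e x), snd (e x)))"
  define orb where "orb = (\<lambda>x. snd (e x))"
  have act: "e (\<alpha> g x) = (g \<otimes> fst (e x), snd (e x))" if "g \<in> carrier G" for g x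
    using that mem by (simp add: \<alpha>_def ed)
  have e_inj: "x = y" if "e x = e y" for x y using that de by metis
  have "sub_action G S i \<alpha> orb"
  proof (intro sub_action.intro sub_action_axioms.intro)
    show "group G" by (rule is_group)
    show "group S" "i \<in> mon S G" by fact+
    show "\<alpha> (g \<otimes> h) x = \<alpha> g (\<alpha> h x)" if "g \<in> carrier G" "h \<in> carrier G" for g h x
      using that mem by (intro e_inj) (simp add: act m_assoc)
    show "\<alpha> \<one> x = x" for x using mem by (intro e_inj) (simp add: act)
    show "g = \<one>" if "g \<in> carrier G" "\<alpha> g x = x" for g x
    proof -
      have "g \<otimes> fst (e x) = fst (e x)" using act[OF that(1), of x] that(2) by (metis fst_conv)
      then show ?thesis using that(1) mem[of x] by (simp add: r_cancel_one)
    qed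
    show "orb x = orb x' \<longleftrightarrow> (\<exists>g\<in>carrier G. x' = \<alpha> g x)" for x x'
    proof
      assume o: "orb x = orb x'"
      let ?g = "fst (e x') \<otimes> inv (fst (e x))"
      have "e x' = e (\<alpha> ?g x)" using o mem by (simp add: act m_assoc orb_def prod_eq_iff)
      then show "\<exists>g\<in>carrier G. x' = \<alpha> g x" using mem e_inj by (intro bexI[of _ ?g]) auto
    qed (auto simp: orb_def act)
    show "\<exists>x. orb x = n" for n using ed[OF one_closed, of n] by (intro exI[of _ "d (\<one>, n)"]) (simp add: orb_def)
  qed
  then show ?thesis by blast
qed

locale amalg_representation = amalg_actions G1 G2 S i1 i2 \<alpha> \<beta> o1 o2
  for G1 :: "('a, 'm) monoid_scheme" and G2 :: "('b, 'n) monoid_scheme"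
    and S :: "('c, 'k) monoid_scheme" and i1 i2
    and \<alpha> :: "'a \<Rightarrow> 'x \<Rightarrow> 'x" and \<beta> :: "'b \<Rightarrow> 'y \<Rightarrow> 'y" and o1 o2 +
  fixes w :: "'x \<Rightarrow> 'y" and \<phi> :: "('a + 'b) list set \<Rightarrow> 'x \<Rightarrow> 'x"
  assumes bij_w: "bij w" and hom_phi: "\<phi> \<in> hom P (BijGroup UNIV)"
    and phi_inl: "g \<in> carrier G1 \<Longrightarrow> \<phi> (inl g) = \<alpha> g"
    and phi_inr: "h \<in> carrier G2 \<Longrightarrow> \<phi> (inr h) = inv_into UNIV w \<circ> \<beta> h \<circ> w"
begin

section \<open>Properties of the action obtained from the bijection\<close>

lemma bij_phi: "a \<in> carrier P \<Longrightarrow> bij (\<phi> a)"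
  using hom_in_carrier[OF hom_phi] by (simp add: BijGroup_UNIV)

lemma phi_mult: "a \<in> carrier P \<Longrightarrow> b \<in> carrier P \<Longrightarrow> \<phi> (a \<otimes>\<^bsub>P\<^esub> b) = \<phi> a \<circ> \<phi> b"
  using hom_mult[OF hom_phi] bij_phi by (simp add: BijGroup_UNIV)

lemma phi_one: "\<phi> \<one>\<^bsub>P\<^esub> = id"
  using hom_one[OF hom_phi P.is_group group_BijGroup] by (simp add: BijGroup_UNIV)

lemma inv_w: "inv_into UNIV w (w x) = x"
  using bij_w by (simp add: bij_is_inj)

text \<open>The link from finite information to the action: \<open>w\<close> extends
  \<open>p\<close>, so the partial trajectories computed from \<open>p\<close> are true
  trajectories.\<close>

lemma phi_trace:
  assumes p: "\<forall>(x, y)\<in>p. w x = y" and "u \<in> W" "(x, x') \<in> trace p u"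
  shows "\<phi> (cls u) x = x'"
  using assms(2,3)
proof (induction u arbitrary: x')
  case Nil
  then show ?case using phi_one by (simp add: one_P)
next
  case (Cons a u)
  then have u: "u \<in> W" by (auto simp: amalg_words_def)
  show ?case
  proof (cases a)
    case (Inl g)
    then have g: "g \<in> carrier G1" using Cons.prems by (auto simp: amalg_words_def)
    then show ?thesis using Cons u Inl by (auto simp: cls_Inl phi_mult phi_inl)
  next
    case (Inr h)
    then have h: "h \<in> carrier G2" using Cons.prems by (auto simp: amalg_words_def)
    obtain x0 y where x0: "(x, x0) \<in> trace p u" "(x0, y) \<in> p" "(x', \<beta> h y) \<in> p"
      using Cons.prems(2) Inr by auto
    then have "w x0 = y" "w x' = \<beta> h y" using p by auto
    then have "inv_into UNIV w (\<beta> h (w x0)) = x'" using inv_w[of x'] by simp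
    then show ?thesis using Cons.IH[OF u x0(1)] h u Inr by (simp add: cls_Inr phi_mult phi_inr)
  qed
qed

lemma faithful:
  assumes "\<And>u. reduced u \<Longrightarrow> u \<noteq> [] \<Longrightarrow> \<exists>p. moved u p \<and> (\<forall>(x, y)\<in>p. w x = y)"
  shows "faithful_action P UNIV \<phi>"
proof -
  have kernel: "a = \<one>\<^bsub>P\<^esub>" if a: "a \<in> carrier P" "\<phi> a = id" for a
    using a(1)
  proof (cases a rule: amalg_cases)
    case (factor g)
    then have "\<alpha> g x = x" for x using a(2) by (metis id_apply phi_inl)
    then have "g = \<one>\<^bsub>G1\<^esub>" using factor(1) A.act_free by blast
    then show ?thesis using factor(2) inl_one by simp
  next
    case (reduced v)
    then obtain p x x' where p: "\<forall>(x, y)\<in>p. w x = y" "(x, x') \<in> trace p v" "x' \<noteq> x"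
      using assms unfolding moved_def by blast
    have "\<phi> a x = x'" unfolding reduced(3) by (rule phi_trace[OF p(1) reduced_words[OF reduced(1)] p(2)])
    then show ?thesis using a(2) p(3) by simp
  qed
  have "inj_on \<phi> (carrier P)"
  proof (rule inj_onI)
    fix a b assume ab: "a \<in> carrier P" "b \<in> carrier P" "\<phi> a = \<phi> b"
    then have "\<phi> (a \<otimes>\<^bsub>P\<^esub> inv\<^bsub>P\<^esub> b) = \<phi> (b \<otimes>\<^bsub>P\<^esub> inv\<^bsub>P\<^esub> b)"
      by (simp only: phi_mult P.inv_closed)
    then have "a \<otimes>\<^bsub>P\<^esub> inv\<^bsub>P\<^esub> b = \<one>\<^bsub>P\<^esub>" using ab by (intro kernel) (simp_all add: phi_one)
    then show "a = b" using ab P.inv_equality P.inv_inv by (metis P.inv_closed)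
  qed
  then show ?thesis
    using hom_phi P.is_group group_BijGroup
    by (auto simp: faithful_action_def faithful_action_axioms_def group_action_def group_hom_def group_hom_axioms_def)
qed

lemma highly_transitive:
  assumes "\<And>l. distinct (map fst l) \<Longrightarrow> distinct (map snd l) \<Longrightarrow> \<exists>p. sends l p \<and> (\<forall>(x, y)\<in>p. w x = y)"
  shows "highly_transitive P UNIV \<phi>"
  unfolding highly_transitive_def
proof (intro allI impI)
  fix n and x y :: "nat \<Rightarrow> 'x"
  assume xy: "x \<in> {1..n} \<rightarrow> UNIV \<and> inj_on x {1..n} \<and> y \<in> {1..n} \<rightarrow> UNIV \<and> inj_on y {1..n}"
  let ?l = "map (\<lambda>k. (x k, y k)) [1..<Suc n]"
  have set: "set [1..<Suc n] = {1..n}" by (simp only: set_upt atLeastLessThanSuc_atLeastAtMost)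
  have "distinct (map fst ?l)" "distinct (map snd ?l)"
    using xy set by (auto simp: distinct_map comp_def simp del: upt_Suc)
  then obtain p where p: "sends ?l p" "\<forall>(x, y)\<in>p. w x = y" using assms by blast
  obtain g g' h where g: "g \<in> carrier G1" "g' \<in> carrier G1" "h \<in> carrier G2"
    "\<forall>(a, b)\<in>set ?l. \<exists>z. (\<alpha> g a, z) \<in> p \<and> (\<alpha> g' b, \<beta> h z) \<in> p"
    using p(1) unfolding sends_def by blast
  \<comment> \<open>The middle letter acts as the conjugate of \<open>h\<close> by \<open>w\<close>
    and leads from \<open>\<alpha> g (x k)\<close> to \<open>\<alpha> g' (y k)\<close>.\<close>
  let ?a = "inl (inv\<^bsub>G1\<^esub> g') \<otimes>\<^bsub>P\<^esub> (inr h \<otimes>\<^bsub>P\<^esub> inl g)"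
  have "\<phi> ?a (x k) = y k" if k: "k \<in> {1..n}" for k
  proof -
    have "(x k, y k) \<in> set ?l" using k set by (simp del: upt_Suc)
    then obtain z where "(\<alpha> g (x k), z) \<in> p" "(\<alpha> g' (y k), \<beta> h z) \<in> p" using g(4) by blast
    then have "w (\<alpha> g (x k)) = z" "w (\<alpha> g' (y k)) = \<beta> h z" using p(2) by auto
    then have "inv_into UNIV w (\<beta> h (w (\<alpha> g (x k)))) = \<alpha> g' (y k)" using inv_w[of "\<alpha> g' (y k)"] by simp
    then show ?thesis using g(1-3) by (simp add: phi_mult phi_inl phi_inr A.act_inv)
  qed
  then show "\<exists>a\<in>carrier P. \<forall>k\<in>{1..n}. \<phi> a (x k) = y k"
    using g(1-3) by (intro bexI[of _ ?a]) simp_all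
qed

lemma invariant_of_factors:
  assumes G1: "\<And>g A. g \<in> carrier G1 \<Longrightarrow> \<mu> (\<alpha> g ` A) = \<mu> A"
    and G2: "\<And>h A. h \<in> carrier G2 \<Longrightarrow> \<mu> ((inv_into UNIV w \<circ> \<beta> h \<circ> w) ` A) = \<mu> A"
    and a: "a \<in> carrier P"
  shows "\<mu> (\<phi> a ` A) = \<mu> A"
proof -
  have "\<mu> (\<phi> (cls u) ` A) = \<mu> A" if "u \<in> W" for u
    using that
  proof (induction u)
    case Nil
    then show ?case using phi_one by (simp add: one_P)
  next
    case (Cons b u)
    then have u: "u \<in> W" by (auto simp: amalg_words_def)
    show ?case
    proof (cases b)
      case (Inl g)
      then have g: "g \<in> carrier G1" using Cons.prems by (auto simp: amalg_words_def)
      have "\<phi> (cls (b # u)) ` A = \<alpha> g ` (\<phi> (cls u) ` A)"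
        using g u Inl by (simp add: cls_Inl phi_mult phi_inl image_comp)
      then show ?thesis using Cons.IH[OF u] G1[OF g] by simp
    next
      case (Inr h)
      then have h: "h \<in> carrier G2" using Cons.prems by (auto simp: amalg_words_def)
      have "\<phi> (cls (b # u)) ` A = (inv_into UNIV w \<circ> \<beta> h \<circ> w) ` (\<phi> (cls u) ` A)"
        using h u Inr by (simp add: cls_Inr phi_mult phi_inr image_comp)
      then show ?thesis using Cons.IH[OF u] G2[OF h] by simp
    qed
  qed
  then show ?thesis using a by (auto simp: carrier_P)
qed

text \<open>Each element of a factor lies in all but finitely many members of the exhaustion, so
  along the sets \<open>C n\<close> its Folner ratio tends to 0. The resulting mean is invariant
  under both factors and hence under the amalgam.\<close>

lemma amenable:
  assumes K1: "\<And>n. K1 n \<subseteq> carrier G1" "incseq K1" "carrier G1 \<subseteq> (\<Union>n. K1 n)"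
    and K2: "\<And>n. K2 n \<subseteq> carrier G2" "incseq K2" "carrier G2 \<subseteq> (\<Union>n. K2 n)"
    and fol: "\<And>n :: nat. \<exists>p. folner_pair (K1 n) (K2 n) (1 / real (Suc n)) p \<and> (\<forall>(x, y)\<in>p. w x = y)"
  shows "amenable_action P UNIV \<phi>"
proof -
  have "\<exists>C. finite C \<and> C \<noteq> {} \<and>
      (\<forall>k\<in>K1 n. real (card (\<alpha> k ` C - C)) \<le> 1 / real (Suc n) * card C) \<and>
      (\<forall>k\<in>K2 n. real (card (\<beta> k ` w ` C - w ` C)) \<le> 1 / real (Suc n) * card C)" for n
  proof -
    obtain p C where p: "\<forall>(x, y)\<in>p. w x = y" and C: "finite C" "C \<noteq> {}" "C \<subseteq> Domain p"
      "\<forall>k\<in>K1 n. real (card (\<alpha> k ` C - C)) \<le> 1 / real (Suc n) * card C"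
      "\<forall>k\<in>K2 n. real (card (\<beta> k ` (p `` C) - p `` C)) \<le> 1 / real (Suc n) * card C"
      using fol[of n] unfolding folner_pair_def by blast
    have "p `` C = w ` C" using p C(3) by force
    then show ?thesis using C by auto
  qed
  then obtain C where C: "\<And>n. finite (C n)" "\<And>n. C n \<noteq> {}"
    and C1: "\<And>n k. k \<in> K1 n \<Longrightarrow> real (card (\<alpha> k ` C n - C n)) \<le> 1 / real (Suc n) * card (C n)"
    and C2: "\<And>n k. k \<in> K2 n \<Longrightarrow> real (card (\<beta> k ` w ` C n - w ` C n)) \<le> 1 / real (Suc n) * card (C n)"
    by metis
  have pos: "0 < real (card (C n))" for n using C by (simp add: card_gt_0_iff)
  have null: "(\<lambda>n. real (card (f ` C n - C n)) / real (card (C n))) \<longlonglongrightarrow> 0"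
    if "\<And>n. n \<ge> m \<Longrightarrow> real (card (f ` C n - C n)) \<le> 1 / real (Suc n) * card (C n)" for f :: "'x \<Rightarrow> 'x" and m
  proof (rule tendsto_0_le[OF LIMSEQ_inverse_real_of_nat, where K = 1], rule eventually_sequentiallyI[of m])
    fix n assume "m \<le> n"
    then show "norm (real (card (f ` C n - C n)) / real (card (C n))) \<le> norm (inverse (real (Suc n))) * 1"
      using that[of n] pos[of n] by (simp add: divide_le_eq inverse_eq_divide)
  qed
  let ?P = "\<alpha> ` carrier G1 \<union> (\<lambda>h. inv_into UNIV w \<circ> \<beta> h \<circ> w) ` carrier G2"
  have "\<exists>\<mu>. fin_additive_prob UNIV \<mu> \<and> (\<forall>f\<in>?P. \<forall>A. \<mu> (f ` A) = \<mu> A)"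
  proof (rule invariant_mean_from_folner[where C = C])
    show "bij f" if "f \<in> ?P" for f
      using that bij_w by (auto intro!: bij_comp A.bij_act B.bij_act bij_imp_bij_inv)
    fix f assume "f \<in> ?P"
    then show "(\<lambda>n. real (card (f ` C n - C n)) / real (card (C n))) \<longlonglongrightarrow> 0"
    proof
      assume "f \<in> \<alpha> ` carrier G1"
      then obtain g m where g: "f = \<alpha> g" "g \<in> K1 m" using K1(3) by blast
      show ?thesis
      proof (rule null)
        fix n assume "m \<le> n"
        then have "g \<in> K1 n" using g(2) K1(2) by (auto dest: incseqD)
        then show "real (card (f ` C n - C n)) \<le> 1 / real (Suc n) * card (C n)" unfolding g(1) by (rule C1)
      qed
    next
      assume "f \<in> (\<lambda>h. inv_into UNIV w \<circ> \<beta> h \<circ> w) ` carrier G2"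
      then obtain h m where h: "f = inv_into UNIV w \<circ> \<beta> h \<circ> w" "h \<in> K2 m" using K2(3) by blast
      show ?thesis
      proof (rule null)
        fix n assume "m \<le> n"
        then have hn: "h \<in> K2 n" using h(2) K2(2) by (auto dest: incseqD)
        \<comment> \<open>Conjugation by \<open>w\<close> carries the boundary of \<open>C n\<close>
          to that of its image, where the Folner estimate for the second factor is known.\<close>
        have "f ` C n - C n = inv_into UNIV w ` (\<beta> h ` w ` C n) - inv_into UNIV w ` (w ` C n)"
          by (simp add: h(1) image_comp comp_def inv_w)
        also have "\<dots> = inv_into UNIV w ` (\<beta> h ` w ` C n - w ` C n)"
          using bij_w by (intro image_set_diff[symmetric]) (simp add: bij_imp_bij_inv bij_is_inj)
        finally have "card (f ` C n - C n) \<le> card (\<beta> h ` w ` C n - w ` C n)"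
          using C(1)[of n] by (simp add: card_image_le)
        then show "real (card (f ` C n - C n)) \<le> 1 / real (Suc n) * card (C n)" using C2[OF hn] by linarith
      qed
    qed
  qed (use C in auto)
  then obtain \<mu> where mu: "fin_additive_prob UNIV \<mu>" "\<forall>f\<in>?P. \<forall>A. \<mu> (f ` A) = \<mu> A" by blast
  have "\<mu> (\<phi> a ` A) = \<mu> A" if "a \<in> carrier P" for a A
    by (rule invariant_of_factors[OF _ _ that]; intro mu(2)[rule_format]) blast+
  then show ?thesis using mu(1) unfolding amenable_action_def by blast
qed

end

section \<open>The generic action of the amalgam\<close>

context amalg_actions begin

text \<open>Equivariance of \<open>w\<close> says that the first action and the conjugated second
  one agree on the common subgroup, which is what the universal property of the amalgam asks
  for.\<close>

lemma ex_representation: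
  assumes w: "bij w" "\<forall>s\<in>carrier S. \<forall>x. w (\<alpha> (i1 s) x) = \<beta> (i2 s) (w x)"
  shows "\<exists>\<phi>. amalg_representation G1 G2 S i1 i2 \<alpha> \<beta> o1 o2 w \<phi>"
proof -
  let ?f2 = "\<lambda>h. inv_into UNIV w \<circ> \<beta> h \<circ> w"
  have bij2: "bij (?f2 h)" if "h \<in> carrier G2" for h
    using that w(1) by (auto intro!: bij_comp B.bij_act bij_imp_bij_inv)
  have ww: "w (inv_into UNIV w y) = y" "inv_into UNIV w (w x) = x" for x y
    using w(1) by (simp_all add: bij_is_inj bij_is_surj surj_f_inv_f)
  have f1: "\<alpha> \<in> hom G1 (BijGroup UNIV)"
    by (rule homI) (auto simp: BijGroup_UNIV A.bij_act A.act_mult fun_eq_iff)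
  have f2: "?f2 \<in> hom G2 (BijGroup UNIV)"
    by (rule homI) (simp_all add: BijGroup_UNIV bij2, auto simp: B.act_mult ww fun_eq_iff)
  have "\<alpha> (i1 s) = ?f2 (i2 s)" if "s \<in> carrier S" for s
  proof
    fix x show "\<alpha> (i1 s) x = ?f2 (i2 s) x" using w(2)[rule_format, OF that, of x, symmetric] by (simp add: ww)
  qed
  then obtain \<phi> where "\<phi> \<in> hom P (BijGroup UNIV)" "\<And>g. g \<in> carrier G1 \<Longrightarrow> \<phi> (inl g) = \<alpha> g"
      "\<And>h. h \<in> carrier G2 \<Longrightarrow> \<phi> (inr h) = ?f2 h"
    unfolding inl_def inr_def
    using amalg_universal[OF A.is_group B.is_group hom1 hom2 group_BijGroup f1 f2] by metis
  then have "amalg_representation G1 G2 S i1 i2 \<alpha> \<beta> o1 o2 w \<phi>"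
    using w(1) by unfold_locales auto
  then show ?thesis by blast
qed

lemma ex_highly_transitive_action:
  assumes ctbl: "countable (UNIV :: 'x set)" "countable (UNIV :: 'y set)"
    and hcf: "highly_core_free G1 \<Sigma>1" "highly_core_free G2 \<Sigma>2"
    and G1: "countable (carrier G1)" "infinite (carrier G1)"
    and G2: "countable (carrier G2)" "infinite (carrier G2)"
  shows "\<exists>\<phi> :: ('a + 'b) list set \<Rightarrow> 'x \<Rightarrow> 'x. faithful_action P UNIV \<phi> \<and> highly_transitive P UNIV \<phi> \<and>
    (amenable_group G1 \<and> amenable_group G2 \<and> finite (carrier S) \<longrightarrow> amenable_action P UNIV \<phi>)"
proof -
  \<comment> \<open>One construction serves both claims: the Folner requirements enter the countable
    list \<open>?D\<close> exactly when \<open>am\<close> holds, next to the other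
    requirements.\<close>
  define am where "am \<longleftrightarrow> amenable_group G1 \<and> amenable_group G2 \<and> finite (carrier S)"
  define K1 where "K1 = (\<lambda>n. from_nat_into (carrier G1) ` {..n})"
  define K2 where "K2 = (\<lambda>n. from_nat_into (carrier G2) ` {..n})"
  have K1: "finite (K1 n)" "K1 n \<subseteq> carrier G1" for n
    using from_nat_into[OF A.carrier_not_empty] by (auto simp: K1_def)
  have K2: "finite (K2 n)" "K2 n \<subseteq> carrier G2" for n
    using from_nat_into[OF B.carrier_not_empty] by (auto simp: K2_def)
  have K1_mono: "incseq K1" and K2_mono: "incseq K2" by (auto simp: K1_def K2_def incseq_def)
  have K1_cover: "carrier G1 \<subseteq> (\<Union>n. K1 n)"
    using from_nat_into_surj[OF G1(1)] by (fastforce simp: K1_def)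
  have K2_cover: "carrier G2 \<subseteq> (\<Union>n. K2 n)"
    using from_nat_into_surj[OF G2(1)] by (fastforce simp: K2_def)
  let ?L = "{l :: ('x \<times> 'x) list. distinct (map fst l) \<and> distinct (map snd l)}"
  let ?U = "{u. reduced u \<and> u \<noteq> []}"
  let ?F = "\<lambda>n :: nat. folner_pair (K1 n) (K2 n) (1 / real (Suc n))"
  let ?D = "sends ` ?L \<union> moved ` ?U \<union> {Q. am \<and> (\<exists>n. Q = ?F n)}"
  have "countable (UNIV :: ('x \<times> 'x) set)"
    using ctbl(1) by (simp flip: UNIV_Times_UNIV)
  then have "countable ?L"
    using countable_lists[of "UNIV :: ('x \<times> 'x) set"] by (intro countable_subset[of ?L "lists UNIV"]) auto
  moreover have "countable ?U"
  proof (rule countable_subset)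
    show "?U \<subseteq> W" using reduced_words by blast
    show "countable W" using G1(1) G2(1) unfolding amalg_words_def by (intro countable_lists) (simp add: Plus_def)
  qed
  moreover have "countable {Q. am \<and> (\<exists>n. Q = ?F n)}"
    by (rule countable_subset[of _ "range ?F"]) auto
  ultimately have D: "countable ?D" by auto
  have dense: "\<exists>p'. cond p' \<and> p \<subseteq> p' \<and> Q p'" if Q: "Q \<in> ?D" and p: "cond p" for Q p
    using Q
  proof (elim UnE)
    assume "Q \<in> sends ` ?L"
    then show ?thesis using dense_sends[OF p hcf G1(2) G2(2)] by blast
  next
    assume "Q \<in> moved ` ?U"
    then show ?thesis using dense_moved[OF p] by blast
  next
    assume "Q \<in> {Q. am \<and> (\<exists>n. Q = ?F n)}"
    then obtain n where n: am "Q = ?F n" by blast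
    then have fin: "amenable_group G1" "amenable_group G2" "finite (carrier S)" by (simp_all add: am_def)
    show ?thesis unfolding n(2)
      by (rule dense_folner_pair[OF p fin(1,2) G1 G2 fin(3) K1 K2]) simp
  qed
  have "\<exists>w. bij w \<and> (\<forall>s\<in>carrier S. \<forall>x. w (\<alpha> (i1 s) x) = \<beta> (i2 s) (w x)) \<and>
    (\<forall>Q\<in>?D. \<exists>p. Q p \<and> (\<forall>(x, y)\<in>p. w x = y))"
    by (rule generic_bijection[OF ctbl D]) (rule dense)
  then obtain w where w: "bij w" "\<forall>s\<in>carrier S. \<forall>x. w (\<alpha> (i1 s) x) = \<beta> (i2 s) (w x)"
    and generic: "\<forall>Q\<in>?D. \<exists>p. Q p \<and> (\<forall>(x, y)\<in>p. w x = y)"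
    by (elim exE conjE) (rule that)
  note met = bspec[OF generic]
  obtain \<phi> where "amalg_representation G1 G2 S i1 i2 \<alpha> \<beta> o1 o2 w \<phi>"
    using ex_representation[OF w(1) w(2)] by (elim exE) (rule that)
  then interpret R: amalg_representation G1 G2 S i1 i2 \<alpha> \<beta> o1 o2 w \<phi> .
  have "faithful_action P UNIV \<phi>" by (rule R.faithful) (intro met, blast)
  moreover have "highly_transitive P UNIV \<phi>" by (rule R.highly_transitive) (intro met, blast)
  moreover have "amenable_action P UNIV \<phi>" if am
    by (rule R.amenable[OF K1(2) K1_mono K1_cover K2(2) K2_mono K2_cover]) (intro met, use that in blast)
  ultimately show ?thesis unfolding am_def by blast
qed

end

theorem theorem3p2:
  fixes G1 :: "('a, 'm) monoid_scheme" and G2 :: "('b, 'n) monoid_scheme"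
    and S :: "('c, 'k) monoid_scheme"
    and i1 :: "'c \<Rightarrow> 'a" and i2 :: "'c \<Rightarrow> 'b"
  assumes "group G1" "infinite (carrier G1)" "countable (carrier G1)"
    and "group G2" "infinite (carrier G2)" "countable (carrier G2)"
    and "group S" "i1 \<in> mon S G1" "i2 \<in> mon S G2"
    and "highly_core_free G1 (i1 ` carrier S)" "highly_core_free G2 (i2 ` carrier S)"
  shows "(\<exists>(X :: nat set) \<phi>. infinite X \<and> countable X \<and>
            faithful_action (amalg G1 G2 S i1 i2) X \<phi> \<and>
            highly_transitive (amalg G1 G2 S i1 i2) X \<phi>) \<and>
         (amenable_group G1 \<and> amenable_group G2 \<and> finite (carrier S) \<longrightarrow>
          (\<exists>(X :: nat set) \<phi>. infinite X \<and> countable X \<and>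
            faithful_action (amalg G1 G2 S i1 i2) X \<phi> \<and>
            highly_transitive (amalg G1 G2 S i1 i2) X \<phi> \<and>
            amenable_action (amalg G1 G2 S i1 i2) X \<phi>))"
proof -
  obtain \<alpha> :: "'a \<Rightarrow> nat \<Rightarrow> nat" and o1 where A: "sub_action G1 S i1 \<alpha> o1"
    using group.regular_sub_action[OF assms(1,2,3,7,8)] by blast
  obtain \<beta> :: "'b \<Rightarrow> nat \<Rightarrow> nat" and o2 where B: "sub_action G2 S i2 \<beta> o2"
    using group.regular_sub_action[OF assms(4,5,6,7,9)] by blast
  interpret amalg_actions G1 G2 S i1 i2 \<alpha> \<beta> o1 o2
    using A B by (rule amalg_actions.intro)
  obtain \<phi> :: "('a + 'b) list set \<Rightarrow> nat \<Rightarrow> nat" where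
    "faithful_action P UNIV \<phi>" "highly_transitive P UNIV \<phi>"
    "amenable_group G1 \<and> amenable_group G2 \<and> finite (carrier S) \<longrightarrow> amenable_action P UNIV \<phi>"
    using ex_highly_transitive_action assms by auto
  then show ?thesis by (intro conjI impI exI[of _ "UNIV :: nat set"] exI[of _ \<phi>]) auto
qed

end
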